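(* Let $n\ge 2$, let $D\subset\mathbb{R}^{n-1}$ be a bounded domain and let $g:D\to(0,\infty)$ be twice continuously differentiable with $g(u)\to 0$ as $u\to\partial D$; extend $g$ by $0$ to $\mathbb{R}^{n-1}\setminus D$. Let $\Omega=\{(u,v)\in\mathbb{R}^{n-1}\times\mathbb{R}: u\in D,\ |v|<g(u)\}$. With the notation $\Phi,\Phi_c,p,N_u,|N_u|,W,V,(\partial\Omega)^+$ defined in the context, the following statements are equivalent. (i) The restriction of $\Phi$ to any convex subdomain of $D$ is convex. (Equivalent formulations of (i): the matrix of second derivatives satisfies $\nabla^2\Phi\ge 0$ (positive semidefinite) in $D$; the extension of $\Phi$ to $\mathbb{R}^{n-1}$ is convex; $W\setminus V$ is a convex set.) (ii) For every $c=(a,b)$ with $a\in\mathbb{R}^{n-1}$, $b>0$, the function $\Phi_c$ is convex (alternatively: strictly convex) when restricted to any convex subdomain of $\{u\in D: g(u)>b\}$. (iii) The restriction of the foot point map $p$ to any convex subdomain of $D$ is monotone, i.e. $(p(u)-p(u'))\cdot(u-u')\ge 0$ for all $u,u'$ in the subdomain. (Equivalently, the matrix $\left(\frac{\partial p_i}{\partial u_j}+\frac{\partial p_j}{\partial u_i}\right)$ is positive semidefinite.) (iv) $\Omega=\bigcup_{u\in D}B(p(u),|N_u|)$. (v) There exist radii $r(u)>0$ such that $\Omega=\bigcup_{u\in D}B(u,r(u))$. (vi) $N_u\cap N_{u'}=\emptyset$ for all $u,u'\in D$ with $u\ne u'$. (vii) The principal curvatures at any point $(u,g(u))$ of $(\partial\Omega)^+$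 are $\ge -\frac{1}{|N_u|}$. (viii) Every point in $\Omega^+$ has a unique closest neighbor on $(\partial\Omega)^+$. (ix) Every point on $(\partial\Omega)^+$ is a closest point on $\partial\Omega$ for some point in $D$. (x) $(\mathbb{R}^n)^+\setminus\Omega$ is convex with respect to the Poincaré metric in $(\mathbb{R}^n)^+$.
   Context: $(\mathbb{R}^n)^+=\{(u,v)\in\mathbb{R}^{n-1}\times\mathbb{R}: v>0\}$, and $A^+=A\cap(\mathbb{R}^n)^+$ for $A\subset\mathbb{R}^n$. The hyperplane $\{v=0\}$ is identified with $\mathbb{R}^{n-1}$, so $D\subset\mathbb{R}^{n-1}$ is also regarded as a subset of $\mathbb{R}^n$; $B(a,r)$ is the open ball in $\mathbb{R}^n$ with center $a$ (possibly $a\in\mathbb{R}^{n-1}$) and radius $r$. $(\partial\Omega)^+$ is the graph $\{(u,g(u)):u\in D\}$. Foot point map: $p(u)=u+g(u)\nabla g(u)$ for $u\in D$. Normal segment: $N_u=\{(u,g(u))+t(\nabla g(u),-1): 0<t<g(u)\}$, with length $|N_u|=g(u)\sqrt{1+|\nabla g(u)|^2}$. $\Phi(u)=\frac12(|u|^2+g(u)^2)$ for $u\in D$, extended to $\mathbb{R}^{n-1}$ by $\Phi(u)=\frac12|u|^2$ for $u\notin D$. For $c=(a,b)$, $a\in\mathbb{R}^{n-1}$, $b\ge 0$: $\Phi_c(u)=\frac12(|u-a|^2+(g(u)-b)^2)$, defined for those $u\in D$ with $g(u)>b$. $W=\{(s,t)\in\mathbb{R}^{n-1}\times\mathbb{R}: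 t>\frac12|s|^2\}$ and $V=\{(s,t)\in W: s\in D,\ t<\Phi(s)\}$. Principal curvatures: with unit normal $\mathbf{n}(u)=(\nabla g(u),-1)/\sqrt{1+|\nabla g(u)|^2}$ and $\mathbf{x}(u)=(u,g(u))$, they are the eigenvalues of the second fundamental form $B=d\mathbf{x}\cdot d\mathbf{n}$ relative to the first fundamental form $A=d\mathbf{x}\cdot d\mathbf{x}$, i.e. of the linear map $C$ with $A(\boldsymbol{\zeta},C\boldsymbol{\xi})=B(\boldsymbol{\zeta},\boldsymbol{\xi})$, where $A_{ij}=\delta_{ij}+\frac{\partial g}{\partial u_i}\frac{\partial g}{\partial u_j}$ and $B_{ij}=\frac{1}{\sqrt{1+|\nabla g|^2}}\frac{\partial^2 g}{\partial u_i\partial u_j}$. The Poincaré metric on $(\mathbb{R}^n)^+$ is $ds^2=\frac{1}{v^2}\left(\sum_{j=1}^{n-1}du_j^2+dv^2\right)$; its geodesics are the vertical half-lines and the vertical semicircles centered on $\mathbb{R}^{n-1}$. A set $E\subset(\mathbb{R}^n)^+$ is convex with respect to it if for every (complete) geodesic $\gamma$ the set $\gamma\cap E$ has at most one connected component. *)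

theory Defs
  imports "HOL-Analysis.Analysis"
begin

(* R^(n-1) is real^'m with CARD('m) = n - 1, so n >= 2 holds automatically; R^n is the
   product (real^'m) \<times> real, whose norm is the Euclidean one.  The hyperplane v = 0 is embedded
   by u |-> (u, 0).  The function g is total and vanishes outside D. *)

definition all_equivalent :: "bool list \<Rightarrow> bool" where
  "all_equivalent Ps \<longleftrightarrow> (\<forall>P\<in>set Ps. \<forall>Q\<in>set Ps. P \<longleftrightarrow> Q)"


subsection \<open>Calculus, matrices and convexity\<close>

definition grad :: "(real^'m \<Rightarrow> real) \<Rightarrow> real^'m \<Rightarrow> real^'m" where
  "grad f u = (\<chi> i. frechet_derivative f (at u) (axis i 1))"

definition hessian :: "(real^'m \<Rightarrow> real) \<Rightarrow> real^'m \<Rightarrow> real^'m^'m" where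
  "hessian f u = jacobian (grad f) (at u)"

(* Intended for open S, since the derivatives are two-sided. *)
definition C2_on :: "(real^'m) set \<Rightarrow> (real^'m \<Rightarrow> real) \<Rightarrow> bool" where
  "C2_on S f \<longleftrightarrow> (\<forall>u\<in>S. f differentiable (at u)) \<and> (\<forall>u\<in>S. grad f differentiable (at u)) \<and>
     continuous_on S (hessian f)"

definition pos_semidef :: "real^'m^'m \<Rightarrow> bool" where
  "pos_semidef A \<longleftrightarrow> transpose A = A \<and> (\<forall>x. 0 \<le> x \<bullet> (A *v x))"

definition strictly_convex_on :: "'a::real_vector set \<Rightarrow> ('a \<Rightarrow> real) \<Rightarrow> bool" where
  "strictly_convex_on S f \<longleftrightarrow> convex S \<and>
    (\<forall>x\<in>S. \<forall>y\<in>S. x \<noteq> y \<longrightarrow>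
      (\<forall>s>0. \<forall>t>0. s + t = 1 \<longrightarrow> f (s *\<^sub>R x + t *\<^sub>R y) < s * f x + t * f y))"

definition convex_subdomain :: "'a::real_normed_vector set \<Rightarrow> 'a set \<Rightarrow> bool" where
  "convex_subdomain S D \<longleftrightarrow> S \<subseteq> D \<and> S \<noteq> {} \<and> open S \<and> convex S"

definition monotone_map_on :: "'a::real_inner set \<Rightarrow> ('a \<Rightarrow> 'a) \<Rightarrow> bool" where
  "monotone_map_on S p \<longleftrightarrow> (\<forall>u\<in>S. \<forall>u'\<in>S. 0 \<le> (p u - p u') \<bullet> (u - u'))"


subsection \<open>The domain and the associated functions\<close>

definition upper :: "((real^'m) \<times> real) set \<Rightarrow> ((real^'m) \<times> real) set" where
  "upper A = A \<inter> {(u, v). 0 < v}"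

definition Omega :: "(real^'m) set \<Rightarrow> (real^'m \<Rightarrow> real) \<Rightarrow> ((real^'m) \<times> real) set" where
  "Omega D g = {(u, v). u \<in> D \<and> \<bar>v\<bar> < g u}"

definition foot :: "(real^'m \<Rightarrow> real) \<Rightarrow> real^'m \<Rightarrow> real^'m" where
  "foot g u = u + g u *\<^sub>R grad g u"

definition normal_segment :: "(real^'m \<Rightarrow> real) \<Rightarrow> real^'m \<Rightarrow> ((real^'m) \<times> real) set" where
  "normal_segment g u = {(u, g u) + t *\<^sub>R (grad g u, -1) | t. 0 < t \<and> t < g u}"

definition normal_length :: "(real^'m \<Rightarrow> real) \<Rightarrow> real^'m \<Rightarrow> real" where
  "normal_length g u = g u * sqrt (1 + (norm (grad g u))\<^sup>2)"

(* As g vanishes outside D, this is already the extension of Phi to all of R^(n-1). *)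
definition Phi :: "(real^'m \<Rightarrow> real) \<Rightarrow> real^'m \<Rightarrow> real" where
  "Phi g u = ((norm u)\<^sup>2 + (g u)\<^sup>2) / 2"

definition Phi_c :: "(real^'m \<Rightarrow> real) \<Rightarrow> real^'m \<Rightarrow> real \<Rightarrow> real^'m \<Rightarrow> real" where
  "Phi_c g a b u = ((norm (u - a))\<^sup>2 + (g u - b)\<^sup>2) / 2"

definition W_set :: "((real^'m) \<times> real) set" where
  "W_set = {(s, t). t > (norm s)\<^sup>2 / 2}"

definition V_set :: "(real^'m) set \<Rightarrow> (real^'m \<Rightarrow> real) \<Rightarrow> ((real^'m) \<times> real) set" where
  "V_set D g = {(s, t) \<in> W_set. s \<in> D \<and> t < Phi g s}"


subsection \<open>Principal curvatures of the graph\<close>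

definition graph_point :: "(real^'m \<Rightarrow> real) \<Rightarrow> real^'m \<Rightarrow> (real^'m) \<times> real" where
  "graph_point g u = (u, g u)"

definition unit_normal :: "(real^'m \<Rightarrow> real) \<Rightarrow> real^'m \<Rightarrow> (real^'m) \<times> real" where
  "unit_normal g u = (1 / sqrt (1 + (norm (grad g u))\<^sup>2)) *\<^sub>R (grad g u, -1)"

definition first_form :: "(real^'m \<Rightarrow> real) \<Rightarrow> real^'m \<Rightarrow> real^'m \<Rightarrow> real^'m \<Rightarrow> real" where
  "first_form g u \<zeta> \<xi> =
     frechet_derivative (graph_point g) (at u) \<zeta> \<bullet> frechet_derivative (graph_point g) (at u) \<xi>"

(* No minus sign: with the normal pointing towards v = 0 this makes
   B_ij = g_ij / sqrt (1 + |grad g|^2), so concave graphs have nonpositive curvatures. *)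
definition second_form :: "(real^'m \<Rightarrow> real) \<Rightarrow> real^'m \<Rightarrow> real^'m \<Rightarrow> real^'m \<Rightarrow> real" where
  "second_form g u \<zeta> \<xi> =
     frechet_derivative (graph_point g) (at u) \<zeta> \<bullet> frechet_derivative (unit_normal g) (at u) \<xi>"

(* Well defined where g is twice differentiable, the first form being positive definite. *)
definition shape_operator :: "(real^'m \<Rightarrow> real) \<Rightarrow> real^'m \<Rightarrow> real^'m \<Rightarrow> real^'m" where
  "shape_operator g u =
     (THE C. linear C \<and> (\<forall>\<zeta> \<xi>. first_form g u \<zeta> (C \<xi>) = second_form g u \<zeta> \<xi>))"

definition principal_curvature :: "(real^'m \<Rightarrow> real) \<Rightarrow> real^'m \<Rightarrow> real \<Rightarrow> bool" where
  "principal_curvature g u \<kappa> \<longleftrightarrow> (\<exists>\<xi>. \<xi> \<noteq> 0 \<and> shape_operator g u \<xi> = \<kappa> *\<^sub>R \<xi>)"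


subsection \<open>Convexity with respect to the Poincare metric\<close>

definition poincare_geodesic :: "((real^'m) \<times> real) set \<Rightarrow> bool" where
  "poincare_geodesic \<gamma> \<longleftrightarrow>
     (\<exists>a. \<gamma> = {(a, v) | v. 0 < v}) \<or>
     (\<exists>a e r. norm e = 1 \<and> 0 < r \<and>
        \<gamma> = {(a + (r * cos \<theta>) *\<^sub>R e, r * sin \<theta>) | \<theta>. 0 < \<theta> \<and> \<theta> < pi})"

(* The library's connected holds for the empty set: it says at most one component. *)
definition poincare_convex :: "((real^'m) \<times> real) set \<Rightarrow> bool" where
  "poincare_convex E \<longleftrightarrow> (\<forall>\<gamma>. poincare_geodesic \<gamma> \<longrightarrow> connected (\<gamma> \<inter> E))"

end

theory Submission
  imports Defs
begin

text \<open>
  The map sending \<open>(x, v)\<close> to \<open>(x, ((norm x)\<^sup>2 + v\<^sup>2) / 2)\<close> linearizes the situation. It carries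
  \<open>Omega D g\<close> to the region from the paraboloid \<open>(norm x)\<^sup>2 / 2\<close> up to, but excluding, the graph of
  \<open>Phi g\<close>, balls centered on the hyperplane to half spaces below affine graphs, and the
  semicircular geodesics of the Poincare metric to chords of the paraboloid. The gradient of \<open>Phi g\<close> on \<open>D\<close>
  is the foot point map, and the tangent plane over \<open>u\<close> corresponds to the ball
  \<open>ball (foot g u, 0) (normal_length g u)\<close>. So all the conditions express convexity of \<open>Phi g\<close>,
  infinitesimally (\<open>second_order_convex\<close>), locally, or globally (\<open>tangent_supported\<close>: tangent planes
  over \<open>D\<close> support \<open>Phi g\<close> everywhere).

  The local conditions (convexity of \<open>Phi g\<close> or \<open>Phi_c g a b\<close> on subdomains, monotonicity of the foot
  point map) give the second order condition by differentiation, and the curvature bound is the same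
  condition because \<open>tangent_form\<close> is the first fundamental form plus \<open>normal_length g u\<close> times the
  second (\<open>curvature_bound_iff\<close>). The passage from local to global is
  \<open>second_order_imp_tangent_supported\<close>: where a segment leaves \<open>D\<close>, the paraboloid takes over as a
  lower bound of \<open>Phi g\<close>. Supporting tangent planes make the extended \<open>Phi g\<close> a supremum of affine
  functions, hence convex, and convexity restricts to subdomains.

  By the dictionary, supporting tangent planes are the same as foot point balls inscribed in
  \<open>Omega D g\<close>. Covers by balls centered on the hyperplane, and balls around points of \<open>D\<close> touching the
  graph, supply affine minorants that make \<open>Phi g\<close> convex (\<open>inscribed_balls_imp_convex\<close>). A
  foot point ball meets the boundary above the hyperplane only at its point of contact, and shrinking it
  towards that point shows that the points of the normal have a unique nearest point and that normals
  are disjoint.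

  The converse from disjoint normals or unique nearest points is the deepest part. A point of the upper
  part of \<open>Omega D g\<close> lies on the normal at its nearest point (\<open>nearest_is_normal\<close>), with a ball touching
  there. If normals are disjoint, a center moved along its normal keeps its nearest point. If nearest
  points are unique, it does so by a fixed point argument (\<open>unique_nearest_extends\<close>). Either way the
  touching ball grows until it is the foot point ball; this happens for a dense set of points of
  contact, and continuity of the tangent planes gives the rest
  (\<open>tangent_supported_if_ball_extension\<close>).
\<close>

section \<open>Gradients and symmetry of second derivatives\<close>

text \<open>
  The gradient lists the partial derivatives, so for a differentiable function it represents the
  derivative: expand the increment in the standard basis.
\<close>

lemma has_derivative_grad:
  fixes f :: "real^'m \<Rightarrow> real"
  assumes "f differentiable (at u)"
  shows "(f has_derivative (\<lambda>h. grad f u \<bullet> h)) (at u)"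
proof -
  have D: "(f has_derivative frechet_derivative f (at u)) (at u)"
    using assms frechet_derivative_works by blast
  interpret linear "frechet_derivative f (at u)"
    using D by (rule has_derivative_linear)
  have "frechet_derivative f (at u) h = grad f u \<bullet> h" for h
  proof -
    have "frechet_derivative f (at u) h
        = frechet_derivative f (at u) (\<Sum>i\<in>UNIV. (h $ i) *\<^sub>R axis i 1)"
      using basis_expansion[of h] by (simp add: scalar_mult_eq_scaleR)
    also have "\<dots> = grad f u \<bullet> h"
      by (simp add: sum scale grad_def inner_vec_def mult.commute)
    finally show ?thesis .
  qed
  then show ?thesis using D by presburger
qed

lemma grad_eqI:
  fixes f :: "real^'m \<Rightarrow> real"
  assumes "(f has_derivative (\<lambda>h. a \<bullet> h)) (at u)"
  shows "grad f u = a"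
  by (simp add: grad_def vec_eq_iff inner_axis flip: fun_cong[OF frechet_derivative_at[OF assms]])

lemma has_derivative_along_line:
  assumes "(f has_derivative (\<lambda>h. a \<bullet> h)) (at (x + t *\<^sub>R d))"
  shows "((\<lambda>t. f (x + t *\<^sub>R d)) has_real_derivative (a \<bullet> d)) (at t)"
proof -
  have "((\<lambda>t. x + t *\<^sub>R d) has_derivative (\<lambda>s. s *\<^sub>R d)) (at t)"
    by (auto intro!: derivative_eq_intros)
  from has_derivative_compose[OF this assms] show ?thesis
    by (simp add: has_field_derivative_def mult_commute_abs)
qed

text \<open>
  A difference quotient of a convex function along a segment is at most the increment over the
  whole segment; the directional derivative is the limit of these quotients.
\<close>

lemma convex_on_gradient_ineq:
  assumes "convex_on S f" "x \<in> S" "y \<in> S" "(f has_derivative (\<lambda>h. a \<bullet> h)) (at x)"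
  shows "f x + a \<bullet> (y - x) \<le> f y"
proof -
  define \<phi> where "\<phi> t = f (x + t *\<^sub>R (y - x))" for t
  have "(\<phi> has_real_derivative (a \<bullet> (y - x))) (at 0)"
    unfolding \<phi>_def by (rule has_derivative_along_line) (simp add: assms)
  then have "((\<lambda>t. (\<phi> t - \<phi> 0) / t) \<longlongrightarrow> a \<bullet> (y - x)) (at_right 0)"
    by (simp add: has_field_derivative_iff filterlim_at_split)
  moreover have "\<forall>\<^sub>F t in at_right 0. (\<phi> t - \<phi> 0) / t \<le> f y - f x"
  proof -
    have "\<forall>\<^sub>F t in at_right (0::real). t \<in> {0<..<1}"
      by (rule eventually_at_right_real) simp
    then show ?thesis
    proof eventually_elim
      case (elim t)
      have "x + t *\<^sub>R (y - x) = (1 - t) *\<^sub>R x + t *\<^sub>R y" by (simp add: algebra_simps)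
      then have "\<phi> t \<le> (1 - t) * f x + t * f y"
        using elim assms(1-3) unfolding \<phi>_def convex_on_def by auto
      then have "\<phi> t - \<phi> 0 \<le> t * (f y - f x)" by (simp add: \<phi>_def algebra_simps)
      then show ?case using elim by (simp add: divide_le_eq mult.commute)
    qed
  qed
  ultimately have "a \<bullet> (y - x) \<le> f y - f x"
    by (rule tendsto_upperbound) simp
  then show ?thesis by simp
qed

text \<open>
  Monotonicity on the segment from \<open>u\<close> to \<open>u + t *\<^sub>R h\<close>, divided by \<open>t\<^sup>2\<close>, becomes the claim as
  \<open>t\<close> tends to 0 from above.
\<close>

lemma derivative_of_monotone_nonneg:
  assumes "monotone_map_on S p" "open S" "u \<in> S" "(p has_derivative p') (at u)"
  shows "0 \<le> p' h \<bullet> h"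
proof -
  have lin: "linear p'" using assms(4) by (rule has_derivative_linear)
  have "((\<lambda>t. u + t *\<^sub>R h) has_derivative (\<lambda>s. s *\<^sub>R h)) (at 0)"
    by (auto intro!: derivative_eq_intros)
  from has_derivative_compose[OF this, of p p'] assms(4)
  have "((\<lambda>t. p (u + t *\<^sub>R h)) has_derivative (\<lambda>s. p' (s *\<^sub>R h))) (at 0)" by simp
  then have "((\<lambda>t. p (u + t *\<^sub>R h) \<bullet> h) has_real_derivative (p' h \<bullet> h)) (at 0)"
    unfolding has_field_derivative_def
    by (rule has_derivative_eq_rhs[OF has_derivative_inner_left])
       (simp add: linear_scale[OF lin] mult.commute fun_eq_iff)
  then have "((\<lambda>t. (p (u + t *\<^sub>R h) \<bullet> h - p u \<bullet> h) / t) \<longlongrightarrow> p' h \<bullet> h) (at_right 0)"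
    by (simp add: has_field_derivative_iff filterlim_at_split)
  moreover have "\<forall>\<^sub>F t in at_right 0. 0 \<le> (p (u + t *\<^sub>R h) \<bullet> h - p u \<bullet> h) / t"
  proof -
    have "((\<lambda>t. u + t *\<^sub>R h) \<longlongrightarrow> u + 0 *\<^sub>R h) (at_right 0)" by (intro tendsto_intros)
    then have "\<forall>\<^sub>F t in at_right 0. u + t *\<^sub>R h \<in> S"
      using assms(2,3) by (intro topological_tendstoD) auto
    moreover have "\<forall>\<^sub>F t in at_right (0::real). 0 < t" by (simp add: eventually_at_right_less)
    ultimately show ?thesis
    proof eventually_elim
      case (elim t)
      then have "0 \<le> (p (u + t *\<^sub>R h) - p u) \<bullet> (t *\<^sub>R h)"
        using assms(1,3) unfolding monotone_map_on_def by force
      then show ?case using elim by (simp add: zero_le_mult_iff inner_diff_left)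
    qed
  qed
  ultimately show ?thesis by (rule tendsto_lowerbound) simp
qed

text \<open>
  Symmetry of second derivatives is derived from the second difference of \<open>f\<close> over the
  parallelogram spanned by \<open>s *\<^sub>R x\<close> and \<open>s *\<^sub>R y\<close>. The mean value theorem in direction \<open>x\<close> turns it
  into a first difference of \<open>G\<close>, which differentiability of \<open>G\<close> at the one point \<open>u\<close> controls.
\<close>

lemma second_difference_estimate:
  fixes f :: "'a::real_inner \<Rightarrow> real"
  assumes "open S" "u \<in> S"
    and f: "\<And>z. z \<in> S \<Longrightarrow> (f has_derivative (\<lambda>h. G z \<bullet> h)) (at z)"
    and G: "(G has_derivative G') (at u)" and "0 < e"
  shows "\<exists>\<delta>>0. \<forall>s. 0 < s \<and> s < \<delta> \<longrightarrow>
     \<bar>f (u + s *\<^sub>R x + s *\<^sub>R y) - f (u + s *\<^sub>R x) - f (u + s *\<^sub>R y) + f u - s\<^sup>2 * (G' y \<bullet> x)\<bar>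
       \<le> e * s\<^sup>2"
proof -
  interpret linear G' using G by (rule has_derivative_linear)
  define M where "M = norm x + norm y + 1"
  have M: "M > 0" "norm x \<le> M" "norm x + norm y \<le> M" unfolding M_def by (auto simp: add_nonneg_pos)
  define e' where "e' = e / (2 * M\<^sup>2)"
  have e': "e' > 0" using M \<open>0 < e\<close> by (simp add: e'_def)
  obtain d1 where d1: "d1 > 0" "ball u d1 \<subseteq> S" using assms(1,2) open_contains_ball by blast
  obtain d2 where d2: "d2 > 0"
    "\<And>z. norm (z - u) < d2 \<Longrightarrow> norm (G z - G u - G' (z - u)) \<le> e' * norm (z - u)"
    using G e' unfolding has_derivative_at_alt by blast
  define \<delta> where "\<delta> = min d1 d2 / M"
  have "\<delta> > 0" using d1 d2 M by (simp add: \<delta>_def)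
  moreover have "\<bar>f (u + s *\<^sub>R x + s *\<^sub>R y) - f (u + s *\<^sub>R x) - f (u + s *\<^sub>R y) + f u
      - s\<^sup>2 * (G' y \<bullet> x)\<bar> \<le> e * s\<^sup>2" if s: "0 < s" "s < \<delta>" for s
  proof -
    have sM: "s * M < d1" "s * M < d2" using s M by (auto simp: \<delta>_def field_simps)
    have near: "norm (a *\<^sub>R y + \<tau> *\<^sub>R x) \<le> s * M" if "0 \<le> \<tau>" "\<tau> \<le> s" "0 \<le> a" "a \<le> s" for \<tau> a
    proof -
      have "norm (a *\<^sub>R y + \<tau> *\<^sub>R x) \<le> a * norm y + \<tau> * norm x"
        using norm_triangle_ineq[of "a *\<^sub>R y" "\<tau> *\<^sub>R x"] that by simp
      also have "\<dots> \<le> s * norm y + s * norm x" using that by (intro add_mono mult_right_mono) auto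
      also have "\<dots> \<le> s * M" using M s by (simp flip: distrib_left add: add.commute)
      finally show ?thesis .
    qed
    have inS: "u + a *\<^sub>R y + \<tau> *\<^sub>R x \<in> S" if "0 \<le> \<tau>" "\<tau> \<le> s" "0 \<le> a" "a \<le> s" for \<tau> a
      using near[OF that] sM d1(2) by (auto simp: subset_eq dist_norm norm_minus_commute algebra_simps)
    have der: "((\<lambda>\<tau>. f (u + s *\<^sub>R y + \<tau> *\<^sub>R x) - f (u + \<tau> *\<^sub>R x)) has_real_derivative
        (G (u + s *\<^sub>R y + \<tau> *\<^sub>R x) \<bullet> x - G (u + \<tau> *\<^sub>R x) \<bullet> x)) (at \<tau>)" if "0 \<le> \<tau>" "\<tau> \<le> s" for \<tau>
      using inS[of \<tau> s] inS[of \<tau> 0] that s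
      by (intro DERIV_diff has_derivative_along_line f) auto
    obtain \<tau> where \<tau>: "0 < \<tau>" "\<tau> < s"
      "(f (u + s *\<^sub>R y + s *\<^sub>R x) - f (u + s *\<^sub>R x)) - (f (u + s *\<^sub>R y + 0 *\<^sub>R x) - f (u + 0 *\<^sub>R x))
        = (s - 0) * (G (u + s *\<^sub>R y + \<tau> *\<^sub>R x) \<bullet> x - G (u + \<tau> *\<^sub>R x) \<bullet> x)"
      using MVT2[OF s(1) der] by blast
    define A where "A = G (u + s *\<^sub>R y + \<tau> *\<^sub>R x) - G u - G' (s *\<^sub>R y + \<tau> *\<^sub>R x)"
    define B where "B = G (u + \<tau> *\<^sub>R x) - G u - G' (\<tau> *\<^sub>R x)"
    have "norm A \<le> e' * (s * M)"
      unfolding A_def using d2(2)[of "u + s *\<^sub>R y + \<tau> *\<^sub>R x"] near[of \<tau> s] \<tau> s sM e'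
      by (force simp: add.assoc intro: order_trans[OF _ mult_left_mono])
    moreover have "norm B \<le> e' * (s * M)"
      unfolding B_def using d2(2)[of "u + \<tau> *\<^sub>R x"] near[of \<tau> 0] \<tau> s sM e'
      by (force intro: order_trans[OF _ mult_left_mono])
    ultimately have "norm (A - B) \<le> 2 * (e' * (s * M))" using norm_triangle_ineq4[of A B] by linarith
    then have "\<bar>(A - B) \<bullet> x\<bar> \<le> 2 * (e' * (s * M)) * M"
      using M e' s by (intro order_trans[OF Cauchy_Schwarz_ineq2] mult_mono) auto
    also have "\<dots> = e * s" using M by (simp add: e'_def power2_eq_square)
    finally have AB: "\<bar>(A - B) \<bullet> x\<bar> \<le> e * s" .
    have "A - B = G (u + s *\<^sub>R y + \<tau> *\<^sub>R x) - G (u + \<tau> *\<^sub>R x) - s *\<^sub>R G' y"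
      by (simp add: A_def B_def add scale)
    then have "G (u + s *\<^sub>R y + \<tau> *\<^sub>R x) \<bullet> x - G (u + \<tau> *\<^sub>R x) \<bullet> x = (A - B) \<bullet> x + s * (G' y \<bullet> x)"
      by (simp add: inner_diff_left)
    then have "f (u + s *\<^sub>R x + s *\<^sub>R y) - f (u + s *\<^sub>R x) - f (u + s *\<^sub>R y) + f u - s\<^sup>2 * (G' y \<bullet> x)
        = s * ((A - B) \<bullet> x)"
      using \<tau>(3) by (simp add: add_ac power2_eq_square distrib_left)
    then show ?thesis using AB s
      by (simp add: abs_mult power2_eq_square mult.left_commute)
  qed
  ultimately show ?thesis by blast
qed

text \<open>
  The second difference is unchanged when \<open>x\<close> and \<open>y\<close> are exchanged, whereas its leading term
  changes from \<open>G' y \<bullet> x\<close> to \<open>G' x \<bullet> y\<close>.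
\<close>

lemma second_derivative_symmetric:
  fixes f :: "'a::real_inner \<Rightarrow> real"
  assumes "open S" "u \<in> S"
    and f: "\<And>z. z \<in> S \<Longrightarrow> (f has_derivative (\<lambda>h. G z \<bullet> h)) (at z)"
    and G: "(G has_derivative G') (at u)"
  shows "G' x \<bullet> y = G' y \<bullet> x"
proof -
  have "\<bar>G' x \<bullet> y - G' y \<bullet> x\<bar> \<le> e" if "0 < e" for e
  proof -
    have "0 < e / 2" using that by simp
    obtain d1 where d1: "d1 > 0" "\<And>s. 0 < s \<Longrightarrow> s < d1 \<Longrightarrow>
     \<bar>f (u + s *\<^sub>R x + s *\<^sub>R y) - f (u + s *\<^sub>R x) - f (u + s *\<^sub>R y) + f u - s\<^sup>2 * (G' y \<bullet> x)\<bar>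
       \<le> e/2 * s\<^sup>2"
      using second_difference_estimate[OF assms \<open>0 < e / 2\<close>, of x y] by blast
    obtain d2 where d2: "d2 > 0" "\<And>s. 0 < s \<Longrightarrow> s < d2 \<Longrightarrow>
     \<bar>f (u + s *\<^sub>R y + s *\<^sub>R x) - f (u + s *\<^sub>R y) - f (u + s *\<^sub>R x) + f u - s\<^sup>2 * (G' x \<bullet> y)\<bar>
       \<le> e/2 * s\<^sup>2"
      using second_difference_estimate[OF assms \<open>0 < e / 2\<close>, of y x] by blast
    define s where "s = min d1 d2 / 2"
    have s: "0 < s" "s < d1" "s < d2" using d1 d2 by (auto simp: s_def)
    have comm: "u + s *\<^sub>R y + s *\<^sub>R x = u + s *\<^sub>R x + s *\<^sub>R y" by simp
    have "\<bar>s\<^sup>2 * (G' x \<bullet> y) - s\<^sup>2 * (G' y \<bullet> x)\<bar> \<le> e * s\<^sup>2"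
      using d1(2)[OF s(1,2)] d2(2)[OF s(1,3), unfolded comm] unfolding abs_le_iff by linarith
    then have "s\<^sup>2 * \<bar>G' x \<bullet> y - G' y \<bullet> x\<bar> \<le> s\<^sup>2 * e"
      by (simp add: abs_mult mult.commute[of e] flip: right_diff_distrib)
    then show ?thesis using s by simp
  qed
  then show ?thesis by (metis abs_le_zero_iff eq_iff_diff_eq_0 field_le_epsilon add_0)
qed

section \<open>Segments leaving an open set and criteria for convexity\<close>

lemma first_exit_cases:
  fixes u d :: "'a::real_normed_vector"
  assumes "open D" "u \<in> D"
  obtains "\<And>s. 0 \<le> s \<Longrightarrow> s \<le> 1 \<Longrightarrow> u + s *\<^sub>R d \<in> D"
  | r where "0 < r" "r \<le> 1" "u + r *\<^sub>R d \<notin> D"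
      "\<And>s. 0 \<le> s \<Longrightarrow> s < r \<Longrightarrow> u + s *\<^sub>R d \<in> D"
proof -
  define K where "K = {0..1} \<inter> (\<lambda>s. u + s *\<^sub>R d) -` (- D)"
  have "compact K" unfolding K_def
    by (intro compact_Int_closed compact_Icc continuous_closed_vimage)
       (use assms(1) in \<open>auto simp: closed_Compl\<close>)
  show ?thesis
  proof (cases "K = {}")
    case True
    then show ?thesis by (intro that(1)) (auto simp: K_def)
  next
    case False
    then obtain r where r: "r \<in> K" "\<And>s. s \<in> K \<Longrightarrow> r \<le> s"
      using compact_attains_inf[OF \<open>compact K\<close>] by blast
    have "r \<noteq> 0" using r(1) assms(2) by (auto simp: K_def)
    show ?thesis
      by (rule that(2)[of r]) (use r \<open>r \<noteq> 0\<close> in \<open>force simp: K_def\<close>)+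
  qed
qed

text \<open>
  A function that is at every point approximated by its affine minorants is a supremum of affine
  functions. Supporting tangent planes and inscribed balls yield such minorants for \<open>Phi g\<close>.
\<close>

lemma convex_on_if_affine_minorants:
  fixes f :: "'a::real_inner \<Rightarrow> real"
  assumes "\<And>x e. 0 < e \<Longrightarrow> \<exists>a c. (\<forall>y. a \<bullet> y + c \<le> f y) \<and> f x < a \<bullet> x + c + e"
  shows "convex_on UNIV f"
proof (rule convex_onI)
  fix t :: real and x y :: 'a assume t: "0 < t" "t < 1"
  show "f ((1 - t) *\<^sub>R x + t *\<^sub>R y) \<le> (1 - t) * f x + t * f y" (is "f ?z \<le> _")
  proof (rule field_le_epsilon)
    fix e :: real assume "0 < e"
    then obtain a c where ac: "\<And>y. a \<bullet> y + c \<le> f y" "f ?z < a \<bullet> ?z + c + e" using assms by blast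
    have "a \<bullet> ?z + c = (1 - t) * (a \<bullet> x + c) + t * (a \<bullet> y + c)"
      by (simp add: inner_add_right algebra_simps)
    also have "\<dots> \<le> (1 - t) * f x + t * f y" using ac(1) t by (intro add_mono mult_left_mono) auto
    finally show "f ?z \<le> (1 - t) * f x + t * f y + e" using ac(2) by linarith
  qed
qed simp

text \<open>
  Weight the two tangent inequalities at the intermediate point: the linear terms cancel.
\<close>

lemma strictly_convex_onI_gradient:
  fixes f :: "'a::real_inner \<Rightarrow> real"
  assumes "convex S" and "\<And>x y. x \<in> S \<Longrightarrow> y \<in> S \<Longrightarrow> y \<noteq> x \<Longrightarrow> f x + G x \<bullet> (y - x) < f y"
  shows "strictly_convex_on S f"
  unfolding strictly_convex_on_def
proof (intro conjI ballI impI allI)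
  fix x y :: 'a and s t :: real
  assume *: "x \<in> S" "y \<in> S" "x \<noteq> y" "0 < s" "0 < t" "s + t = 1"
  define z where "z = s *\<^sub>R x + t *\<^sub>R y"
  have "z \<in> S" using * assms(1) unfolding z_def convex_def by auto
  have s: "s = 1 - t" using * by simp
  have zx: "x - z = t *\<^sub>R (x - y)" and zy: "y - z = s *\<^sub>R (y - x)"
    by (simp_all add: z_def s algebra_simps)
  then have "x \<noteq> z" "y \<noteq> z" using * by auto
  then have "s * (f z + G z \<bullet> (x - z)) + t * (f z + G z \<bullet> (y - z)) < s * f x + t * f y"
    using * \<open>z \<in> S\<close> assms(2) by (intro add_strict_mono mult_strict_left_mono) auto
  moreover have "s * (f z + G z \<bullet> (x - z)) + t * (f z + G z \<bullet> (y - z)) = f z"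
    unfolding zx zy by (simp add: s inner_diff_right algebra_simps)
  ultimately show "f (s *\<^sub>R x + t *\<^sub>R y) < s * f x + t * f y" by (simp add: z_def)
qed (rule assms)

lemma strictly_convex_on_imp_convex_on:
  assumes "strictly_convex_on S f"
  shows "convex_on S f"
proof (rule convex_onI)
  show "convex S" using assms by (simp add: strictly_convex_on_def)
  fix t :: real and x y assume "0 < t" "t < 1" "x \<in> S" "y \<in> S"
  then show "f ((1 - t) *\<^sub>R x + t *\<^sub>R y) \<le> (1 - t) * f x + t * f y"
    using assms
    by (cases "x = y") (auto simp: strictly_convex_on_def intro!: less_imp_le simp flip: scaleR_left.add distrib_right)
qed

lemma transpose_eq_iff_symmetric_form:
  fixes A :: "real^'m^'m"
  shows "transpose A = A \<longleftrightarrow> (\<forall>x y. x \<bullet> (A *v y) = (A *v x) \<bullet> y)"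
proof
  assume "transpose A = A"
  then show "\<forall>x y. x \<bullet> (A *v y) = (A *v x) \<bullet> y"
    by (metis dot_lmul_matrix transpose_matrix_vector)
next
  assume *: "\<forall>x y. x \<bullet> (A *v y) = (A *v x) \<bullet> y"
  have "A $ i $ j = A $ j $ i" for i j
    using *[rule_format, of "axis i 1" "axis j 1"]
    by (simp add: matrix_vector_mult_basis inner_axis inner_axis' column_def)
  then show "transpose A = A" by (simp add: transpose_def vec_eq_iff)
qed

section \<open>The domain and the function Phi\<close>

text \<open>
  The limit condition at the frontier serves to make \<open>g\<close>, which vanishes outside \<open>D\<close>, continuous
  on the whole hyperplane.
\<close>

locale graph_domain =
  fixes D :: "(real^'m) set" and g :: "real^'m \<Rightarrow> real"
  assumes open_D: "open D"
    and g_pos: "\<And>u. u \<in> D \<Longrightarrow> 0 < g u"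
    and g_zero: "\<And>u. u \<notin> D \<Longrightarrow> g u = 0"
    and g_C2: "C2_on D g"
    and g_boundary: "\<And>\<xi>. \<xi> \<in> frontier D \<Longrightarrow> (g \<longlongrightarrow> 0) (at \<xi> within D)"
begin

lemma g_nonneg: "0 \<le> g u"
  using g_pos g_zero by (cases "u \<in> D") (auto intro: less_imp_le)

lemma mem_D_iff: "u \<in> D \<longleftrightarrow> 0 < g u"
  using g_pos g_zero by force

lemma g_has_derivative: "u \<in> D \<Longrightarrow> (g has_derivative (\<lambda>h. grad g u \<bullet> h)) (at u)"
  using g_C2 by (intro has_derivative_grad) (auto simp: C2_on_def)

lemma grad_has_derivative: "u \<in> D \<Longrightarrow> (grad g has_derivative (\<lambda>h. hessian g u *v h)) (at u)"
  using g_C2 by (auto simp: C2_on_def hessian_def simp flip: jacobian_works)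

lemma continuous_on_g: "continuous_on UNIV g"
proof -
  have "isCont g u" for u
  proof -
    consider "u \<in> D" | "u \<notin> closure D" | "u \<in> frontier D"
      using open_D by (auto simp: frontier_def interior_open)
    then show ?thesis
    proof cases
      case 1
      then show ?thesis using g_has_derivative has_derivative_continuous by blast
    next
      case 2
      then have "\<forall>\<^sub>F x in nhds u. x \<in> - closure D"
        by (intro eventually_nhds_in_open) auto
      then have "\<forall>\<^sub>F x in nhds u. g x = 0"
        by eventually_elim (use closure_subset g_zero in blast)
      then show ?thesis using isCont_cong[of g "\<lambda>_. 0" u] by simp
    next
      case 3
      then have "u \<notin> D" using open_D by (auto simp: frontier_def interior_open)
      have "(g \<longlongrightarrow> 0) (at u within - D)"
        by (rule tendsto_eventually) (auto simp: eventually_at_filter g_zero)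
      with g_boundary[OF 3] have "(g \<longlongrightarrow> 0) (at u within D \<union> - D)"
        by (rule Lim_Un)
      moreover have "D \<union> - D = UNIV" by auto
      ultimately show ?thesis using g_zero[OF \<open>u \<notin> D\<close>] by (simp add: isCont_def)
    qed
  qed
  then show ?thesis by (simp add: continuous_at_imp_continuous_on)
qed

lemma continuous_on_Phi: "continuous_on UNIV (Phi g)"
  unfolding Phi_def by (intro continuous_intros continuous_on_g) auto

lemma Phi_ge: "(norm x)\<^sup>2 / 2 \<le> Phi g x"
  by (simp add: Phi_def)

lemma Phi_outside: "x \<notin> D \<Longrightarrow> Phi g x = (norm x)\<^sup>2 / 2"
  by (simp add: Phi_def g_zero)

lemma Phi_has_derivative: "u \<in> D \<Longrightarrow> (Phi g has_derivative (\<lambda>h. foot g u \<bullet> h)) (at u)"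
  unfolding Phi_def foot_def power2_norm_eq_inner
  by (auto intro!: derivative_eq_intros g_has_derivative
      simp: fun_eq_iff inner_add_left inner_add_right inner_commute)

lemma foot_has_derivative:
  assumes "u \<in> D"
  shows "(foot g has_derivative
    (\<lambda>h. h + (g u *\<^sub>R (hessian g u *v h) + (grad g u \<bullet> h) *\<^sub>R grad g u))) (at u)"
  unfolding foot_def[abs_def]
  by (auto intro!: derivative_eq_intros g_has_derivative grad_has_derivative assms)

text \<open>
  The quadratic form of the second derivative of \<open>Phi g\<close>, whose gradient is the foot point map.
\<close>

definition tangent_form :: "real^'m \<Rightarrow> real^'m \<Rightarrow> real" where
  "tangent_form u x = x \<bullet> x + (grad g u \<bullet> x)\<^sup>2 + g u * (x \<bullet> (hessian g u *v x))"

text \<open>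
  The infinitesimal form of all the conditions. Local convexity statements are reduced to it.
\<close>

definition second_order_convex :: bool where
  "second_order_convex \<longleftrightarrow> (\<forall>u\<in>D. \<forall>x. 0 \<le> tangent_form u x)"

text \<open>
  The global form of all the conditions: the tangent planes of \<open>Phi g\<close> over \<open>D\<close> lie below \<open>Phi g\<close>
  on the whole hyperplane. In terms of \<open>Omega D g\<close>, the tangent plane over \<open>u\<close> corresponds to
  the ball centered at the foot point of \<open>u\<close> that touches the graph over \<open>u\<close>.
\<close>

definition tangent_supported :: bool where
  "tangent_supported \<longleftrightarrow> (\<forall>u\<in>D. \<forall>x. Phi g u + foot g u \<bullet> (x - u) \<le> Phi g x)"

lemma jacobian_foot:
  assumes "u \<in> D"
  shows "jacobian (foot g) (at u) *v h = h + (g u *\<^sub>R (hessian g u *v h) + (grad g u \<bullet> h) *\<^sub>R grad g u)"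
proof -
  have "(foot g has_derivative (\<lambda>h. jacobian (foot g) (at u) *v h)) (at u)"
    using foot_has_derivative[OF assms] by (auto simp: differentiable_def simp flip: jacobian_works)
  from has_derivative_unique[OF this foot_has_derivative[OF assms]] show ?thesis by metis
qed

lemma jacobian_foot_form:
  assumes "u \<in> D"
  shows "x \<bullet> (jacobian (foot g) (at u) *v x) = tangent_form u x"
  by (simp add: jacobian_foot assms tangent_form_def inner_add_right inner_commute power2_eq_square)

lemma hessian_symmetric:
  assumes "u \<in> D"
  shows "x \<bullet> (hessian g u *v y) = (hessian g u *v x) \<bullet> y"
  using second_derivative_symmetric[OF open_D assms g_has_derivative grad_has_derivative[OF assms], of x y]
  by (simp add: inner_commute)

lemma hessian_Phi:
  assumes "u \<in> D"
  shows "hessian (Phi g) u = jacobian (foot g) (at u)"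
proof -
  have "grad (Phi g) x = foot g x" if "x \<in> D" for x
    using Phi_has_derivative[OF that] by (rule grad_eqI)
  then have "(grad (Phi g) has_derivative (\<lambda>h. jacobian (foot g) (at u) *v h)) (at u)"
    using has_derivative_transform_within_open[OF foot_has_derivative[OF assms] open_D assms]
    by (simp add: jacobian_foot[OF assms, abs_def] fun_eq_iff)
  then have "jacobian (foot g) (at u) *v h = jacobian (grad (Phi g)) (at u) *v h" for h
    using has_derivative_unique jacobian_works[of "grad (Phi g)" "at u"]
    by (metis differentiableI)
  then show ?thesis by (simp add: hessian_def matrix_eq)
qed

lemma pos_semidef_hessian_Phi_iff:
  "(\<forall>u\<in>D. pos_semidef (hessian (Phi g) u)) \<longleftrightarrow> second_order_convex"
proof -
  have "transpose (hessian (Phi g) u) = hessian (Phi g) u" if "u \<in> D" for u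
    using hessian_symmetric[OF that]
    by (simp add: transpose_eq_iff_symmetric_form hessian_Phi that jacobian_foot
        inner_add_left inner_add_right inner_commute)
  then show ?thesis
    by (simp add: second_order_convex_def pos_semidef_def hessian_Phi jacobian_foot_form)
qed

lemma pos_semidef_foot_iff:
  "(\<forall>u\<in>D. pos_semidef (\<chi> i j. jacobian (foot g) (at u) $ i $ j + jacobian (foot g) (at u) $ j $ i))
     \<longleftrightarrow> second_order_convex"
proof -
  have "x \<bullet> ((\<chi> i j. jacobian (foot g) (at u) $ i $ j + jacobian (foot g) (at u) $ j $ i) *v x)
      = 2 * tangent_form u x" if "u \<in> D" for u x
  proof -
    have "(\<chi> i j. jacobian (foot g) (at u) $ i $ j + jacobian (foot g) (at u) $ j $ i)
        = jacobian (foot g) (at u) + transpose (jacobian (foot g) (at u))"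
      by (simp add: vec_eq_iff transpose_def)
    moreover have "x \<bullet> (transpose (jacobian (foot g) (at u)) *v x) = tangent_form u x"
      using jacobian_foot_form[OF that, of x]
      by (metis dot_lmul_matrix inner_commute transpose_matrix_vector)
    ultimately show ?thesis
      by (simp add: matrix_vector_mult_add_rdistrib inner_add_right jacobian_foot_form that)
  qed
  moreover have "transpose (\<chi> i j. jacobian (foot g) (at u) $ i $ j + jacobian (foot g) (at u) $ j $ i)
     = (\<chi> i j. jacobian (foot g) (at u) $ i $ j + jacobian (foot g) (at u) $ j $ i)" for u
    by (simp add: transpose_def vec_eq_iff add.commute)
  ultimately show ?thesis by (simp add: second_order_convex_def pos_semidef_def)
qed

text \<open>
  As long as the segment stays in \<open>D\<close> this is the one-dimensional second derivative test; the end
  point, which may lie on the boundary, is reached by continuity.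
\<close>

lemma convex_along_segment:
  assumes "second_order_convex" "u \<in> D" "0 < r"
    and in_D: "\<And>s. 0 \<le> s \<Longrightarrow> s < r \<Longrightarrow> u + s *\<^sub>R d \<in> D"
  shows "Phi g u + r * (foot g u \<bullet> d) \<le> Phi g (u + r *\<^sub>R d)"
proof -
  have d1: "((\<lambda>s. Phi g (u + s *\<^sub>R d)) has_real_derivative foot g (u + s *\<^sub>R d) \<bullet> d) (at s)"
    if "s \<in> {0..<r}" for s
    using that in_D by (intro has_derivative_along_line Phi_has_derivative) auto
  have d2: "((\<lambda>s. foot g (u + s *\<^sub>R d) \<bullet> d) has_real_derivative
      (jacobian (foot g) (at (u + s *\<^sub>R d)) *v d) \<bullet> d) (at s)" if "s \<in> {0..<r}" for s
  proof -
    have "u + s *\<^sub>R d \<in> D" using that in_D by auto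
    have "((\<lambda>x. foot g x \<bullet> d) has_derivative
        (\<lambda>h. (jacobian (foot g) (at (u + s *\<^sub>R d)) *v h) \<bullet> d)) (at (u + s *\<^sub>R d))"
      using foot_has_derivative[OF \<open>u + s *\<^sub>R d \<in> D\<close>]
      by (intro has_derivative_inner_left) (simp add: jacobian_foot[OF \<open>u + s *\<^sub>R d \<in> D\<close>])
    moreover have "(jacobian (foot g) (at (u + s *\<^sub>R d)) *v h) \<bullet> d
        = (jacobian (foot g) (at (u + s *\<^sub>R d)) *v d) \<bullet> h" for h
      using hessian_symmetric[OF \<open>u + s *\<^sub>R d \<in> D\<close>, of d h]
      by (simp add: jacobian_foot \<open>u + s *\<^sub>R d \<in> D\<close> inner_add_left inner_add_right inner_commute)
    ultimately have "((\<lambda>x. foot g x \<bullet> d) has_derivative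
        (\<lambda>h. (jacobian (foot g) (at (u + s *\<^sub>R d)) *v d) \<bullet> h)) (at (u + s *\<^sub>R d))"
      by simp
    then show ?thesis by (rule has_derivative_along_line)
  qed
  have nonneg: "0 \<le> (jacobian (foot g) (at (u + s *\<^sub>R d)) *v d) \<bullet> d" if "s \<in> {0..<r}" for s
    using assms(1) in_D[of s] that jacobian_foot_form[of "u + s *\<^sub>R d" d]
    by (auto simp: second_order_convex_def inner_commute[of d])
  have *: "foot g u \<bullet> d * s \<le> Phi g (u + s *\<^sub>R d) - Phi g u" if "s \<in> {0..<r}" for s
  proof -
    have "foot g (u + 0 *\<^sub>R d) \<bullet> d * (s - 0) \<le> Phi g (u + s *\<^sub>R d) - Phi g (u + 0 *\<^sub>R d)"
      by (rule f''_imp_f'[OF convex_real_interval(7) d1 d2 nonneg]) (use that assms(3) in auto)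
    then show ?thesis by simp
  qed
  have "((\<lambda>s. Phi g (u + s *\<^sub>R d) - Phi g u) \<longlongrightarrow> Phi g (u + r *\<^sub>R d) - Phi g u) (at_left r)"
    by (intro tendsto_intros isCont_tendsto_compose[of _ "Phi g"])
       (use continuous_on_Phi in \<open>auto simp: continuous_on_eq_continuous_at\<close>)
  moreover have "((\<lambda>s. foot g u \<bullet> d * s) \<longlongrightarrow> foot g u \<bullet> d * r) (at_left r)"
    by (intro tendsto_intros)
  moreover have "\<forall>\<^sub>F s in at_left r. foot g u \<bullet> d * s \<le> Phi g (u + s *\<^sub>R d) - Phi g u"
    using eventually_at_left_real[OF \<open>0 < r\<close>] by eventually_elim (use * in auto)
  ultimately have "foot g u \<bullet> d * r \<le> Phi g (u + r *\<^sub>R d) - Phi g u"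
    by (intro tendsto_le[where F="at_left r"]) auto
  then show ?thesis by (simp add: mult.commute)
qed

section \<open>From the second order condition to supporting tangent planes\<close>

text \<open>
  The step from local to global, for a domain that need not be convex. Follow the segment from
  \<open>u\<close> to \<open>x\<close>. If it stays in \<open>D\<close>, the second derivative test applies. Otherwise let \<open>r\<close> be the
  parameter of its first exit. There \<open>Phi g\<close> equals the paraboloid \<open>(norm x)\<^sup>2 / 2\<close>, so the
  paraboloid is above the tangent plane at \<open>r\<close>; at the start it is below. The difference of the
  two is convex, hence it stays nonnegative after \<open>r\<close>, and \<open>Phi g\<close> is above the paraboloid
  everywhere.
\<close>

lemma second_order_imp_tangent_supported:
  assumes "second_order_convex"
  shows "tangent_supported"
  unfolding tangent_supported_def
proof (intro ballI allI)
  fix u x assume "u \<in> D"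
  define d where "d = x - u"
  have x: "x = u + d" by (simp add: d_def)
  show "Phi g u + foot g u \<bullet> (x - u) \<le> Phi g x"
    using open_D \<open>u \<in> D\<close>
  proof (cases rule: first_exit_cases[where d = d])
    case 1
    show ?thesis
      using convex_along_segment[OF assms \<open>u \<in> D\<close>, of 1 d] 1 by (simp add: x)
  next
    case (2 r)
    define m where "m = foot g u \<bullet> d"
    have "Phi g u + r * m \<le> (norm (u + r *\<^sub>R d))\<^sup>2 / 2"
      using convex_along_segment[OF assms \<open>u \<in> D\<close> 2(1,4)] 2(3) by (simp add: Phi_outside m_def)
    moreover have "(norm (u + r *\<^sub>R d))\<^sup>2 = u \<bullet> u + 2 * r * (u \<bullet> d) + r\<^sup>2 * (d \<bullet> d)"
      unfolding power2_norm_eq_inner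
      by (simp add: inner_add_left inner_add_right inner_commute power2_eq_square)
    ultimately have "Phi g u + r * m \<le> (u \<bullet> u + 2 * r * (u \<bullet> d) + r\<^sup>2 * (d \<bullet> d)) / 2"
      by simp
    moreover have "u \<bullet> u / 2 \<le> Phi g u" using Phi_ge[of u] by (simp add: power2_norm_eq_inner)
    ultimately have "r * m \<le> r * (u \<bullet> d + r * (d \<bullet> d) / 2)"
      by (simp add: algebra_simps power2_eq_square)
    then have m: "m \<le> u \<bullet> d + r * (d \<bullet> d) / 2" using 2(1) by simp
    have "(1 - r) * m \<le> (1 - r) * (u \<bullet> d + r * (d \<bullet> d) / 2)"
      using m 2(2) by (intro mult_left_mono) auto
    also have "\<dots> \<le> (1 - r) * (u \<bullet> d) + (1 - r\<^sup>2) * (d \<bullet> d) / 2"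
    proof -
      have "0 \<le> (1 - r) * (d \<bullet> d)" using 2(2) by simp
      then show ?thesis by (simp add: field_simps power2_eq_square)
    qed
    finally have "Phi g u + m \<le> (u \<bullet> u + 2 * (u \<bullet> d) + d \<bullet> d) / 2"
      using \<open>Phi g u + r * m \<le> (u \<bullet> u + 2 * r * (u \<bullet> d) + r\<^sup>2 * (d \<bullet> d)) / 2\<close>
      by (simp add: field_simps)
    also have "\<dots> = (norm x)\<^sup>2 / 2"
      by (simp add: x power2_norm_eq_inner inner_add_left inner_add_right inner_commute)
    also have "\<dots> \<le> Phi g x" by (rule Phi_ge)
    finally show ?thesis by (simp add: m_def d_def)
  qed
qed

text \<open>
  Outside \<open>D\<close> the tangent planes of the paraboloid \<open>(norm x)\<^sup>2 / 2\<close> serve as minorants, so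
  minorants have to be supplied over \<open>D\<close> only.
\<close>

lemma convex_on_UNIV_Phi_if_minorants:
  assumes "\<And>x e. x \<in> D \<Longrightarrow> 0 < e \<Longrightarrow> \<exists>a c. (\<forall>y. a \<bullet> y + c \<le> Phi g y) \<and> Phi g x < a \<bullet> x + c + e"
  shows "convex_on UNIV (Phi g)"
proof (rule convex_on_if_affine_minorants)
  fix x :: "real^'m" and e :: real assume "0 < e"
  show "\<exists>a c. (\<forall>y. a \<bullet> y + c \<le> Phi g y) \<and> Phi g x < a \<bullet> x + c + e"
  proof (cases "x \<in> D")
    case True
    then show ?thesis using assms \<open>0 < e\<close> by blast
  next
    case False
    have "x \<bullet> y + - (x \<bullet> x) / 2 \<le> Phi g y" for y
      using Phi_ge[of y] inner_ge_zero[of "x - y"]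
      by (simp add: power2_norm_eq_inner inner_diff_left inner_diff_right inner_commute)
    moreover have "Phi g x < x \<bullet> x + - (x \<bullet> x) / 2 + e"
      using False \<open>0 < e\<close> by (simp add: Phi_outside power2_norm_eq_inner)
    ultimately show ?thesis by blast
  qed
qed

lemma tangent_supported_imp_convex:
  assumes "tangent_supported"
  shows "convex_on UNIV (Phi g)"
proof (rule convex_on_UNIV_Phi_if_minorants)
  fix u :: "real^'m" and e :: real assume "u \<in> D" "0 < e"
  then have "(\<forall>y. foot g u \<bullet> y + (Phi g u - foot g u \<bullet> u) \<le> Phi g y)
      \<and> Phi g u < foot g u \<bullet> u + (Phi g u - foot g u \<bullet> u) + e"
    using assms by (auto simp: tangent_supported_def inner_diff_right algebra_simps)
  then show "\<exists>a c. (\<forall>y. a \<bullet> y + c \<le> Phi g y) \<and> Phi g u < a \<bullet> u + c + e" by blast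
qed

section \<open>Reduction of the local conditions to the second order condition\<close>

lemma second_order_if_monotone:
  assumes "\<And>u. u \<in> D \<Longrightarrow> \<exists>S. open S \<and> u \<in> S \<and> monotone_map_on S (foot g)"
  shows "second_order_convex"
  unfolding second_order_convex_def
proof (intro ballI allI)
  fix u x assume "u \<in> D"
  then obtain S where "open S" "u \<in> S" "monotone_map_on S (foot g)" using assms by blast
  from derivative_of_monotone_nonneg[OF this(3,1,2) foot_has_derivative[OF \<open>u \<in> D\<close>], of x]
  show "0 \<le> tangent_form u x"
    by (simp add: tangent_form_def inner_add_left inner_add_right inner_commute power2_eq_square add_ac)
qed

lemma monotone_if_convex:
  assumes "convex_on S (Phi g)" "S \<subseteq> D"
  shows "monotone_map_on S (foot g)"
  unfolding monotone_map_on_def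
proof (intro ballI)
  fix u u' assume "u \<in> S" "u' \<in> S"
  then have "Phi g u + foot g u \<bullet> (u' - u) \<le> Phi g u'" "Phi g u' + foot g u' \<bullet> (u - u') \<le> Phi g u"
    using assms by (auto intro!: convex_on_gradient_ineq[OF assms(1)] Phi_has_derivative)
  then show "0 \<le> (foot g u - foot g u') \<bullet> (u - u')"
    by (simp add: inner_diff_left inner_diff_right)
qed

lemma small_convex_subdomain:
  assumes "open E" "u \<in> E"
  obtains r where "0 < r" "convex_subdomain (ball u r) E"
proof -
  obtain r where "r > 0" "ball u r \<subseteq> E" using assms open_contains_ball by blast
  then show ?thesis by (intro that[of r]) (auto simp: convex_subdomain_def)
qed

lemma second_order_if_locally_convex:
  assumes "\<And>u. u \<in> D \<Longrightarrow> \<exists>r>0. ball u r \<subseteq> D \<and> convex_on (ball u r) (Phi g)"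
  shows "second_order_convex"
proof (rule second_order_if_monotone)
  fix u assume "u \<in> D"
  then obtain r where r: "r > 0" "ball u r \<subseteq> D" "convex_on (ball u r) (Phi g)" using assms by blast
  then have "monotone_map_on (ball u r) (foot g)" by (intro monotone_if_convex)
  then show "\<exists>S. open S \<and> u \<in> S \<and> monotone_map_on S (foot g)"
    using r(1) by (intro exI[of _ "ball u r"]) auto
qed

lemma convex_subdomains_imp_second_order:
  assumes "\<forall>S. convex_subdomain S D \<longrightarrow> convex_on S (Phi g)"
  shows "second_order_convex"
proof (rule second_order_if_locally_convex)
  fix u assume "u \<in> D"
  then obtain r where r: "0 < r" "convex_subdomain (ball u r) D"
    using small_convex_subdomain[OF open_D] by blast
  then have "ball u r \<subseteq> D" "convex_on (ball u r) (Phi g)"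
    using assms by (simp_all add: convex_subdomain_def)
  with r(1) show "\<exists>r>0. ball u r \<subseteq> D \<and> convex_on (ball u r) (Phi g)" by blast
qed

lemma monotone_subdomains_imp_second_order:
  assumes "\<forall>S. convex_subdomain S D \<longrightarrow> monotone_map_on S (foot g)"
  shows "second_order_convex"
proof (rule second_order_if_monotone)
  fix u assume "u \<in> D"
  then obtain r where "0 < r" "convex_subdomain (ball u r) D"
    using small_convex_subdomain[OF open_D] by blast
  then show "\<exists>S. open S \<and> u \<in> S \<and> monotone_map_on S (foot g)"
    using assms by (intro exI[of _ "ball u r"]) auto
qed

lemma convex_Phi_imp_subdomains:
  assumes "convex_on UNIV (Phi g)"
  shows "\<forall>S. convex_subdomain S D \<longrightarrow> convex_on S (Phi g)"
  using convex_on_subset[OF assms] by (auto simp: convex_subdomain_def)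

section \<open>The epigraph and the functions with a shifted center\<close>

text \<open>
  Up to boundary points of \<open>W_set\<close>, the set \<open>W_set - V_set D g\<close> is the epigraph of \<open>Phi g\<close>. Outside
  \<open>D\<close> it is the strict epigraph, whence the slack \<open>e\<close> in one direction and strict convexity of the
  paraboloid in the other.
\<close>

lemma convex_W_minus_V_iff:
  "convex (W_set - V_set D g) \<longleftrightarrow> convex_on UNIV (Phi g)"
proof
  have mem: "(s, t) \<in> W_set - V_set D g \<longleftrightarrow> (norm s)\<^sup>2 / 2 < t \<and> Phi g s \<le> t" for s t
    by (cases "s \<in> D") (auto simp: W_set_def V_set_def Phi_outside)
  {
    assume conv: "convex (W_set - V_set D g)"
    show "convex_on UNIV (Phi g)"
    proof (rule convex_onI)
      fix t :: real and x y :: "real^'m" assume t: "0 < t" "t < 1"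
      show "Phi g ((1 - t) *\<^sub>R x + t *\<^sub>R y) \<le> (1 - t) * Phi g x + t * Phi g y"
      proof (rule field_le_epsilon)
        fix e :: real assume "0 < e"
        then have "(x, Phi g x + e) \<in> W_set - V_set D g" "(y, Phi g y + e) \<in> W_set - V_set D g"
          unfolding mem using Phi_ge[of x] Phi_ge[of y] by auto
        then have "(1 - t) *\<^sub>R (x, Phi g x + e) + t *\<^sub>R (y, Phi g y + e) \<in> W_set - V_set D g"
          using t by (intro convexD[OF conv]) auto
        then have "((1 - t) *\<^sub>R x + t *\<^sub>R y, (1 - t) * (Phi g x + e) + t * (Phi g y + e))
            \<in> W_set - V_set D g" by simp
        then show "Phi g ((1 - t) *\<^sub>R x + t *\<^sub>R y) \<le> (1 - t) * Phi g x + t * Phi g y + e"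
          unfolding mem by (simp add: algebra_simps)
      qed
    qed simp
  }
  {
    assume conv: "convex_on UNIV (Phi g)"
    show "convex (W_set - V_set D g)"
      unfolding convex_alt
    proof (intro ballI allI impI)
      fix P Q :: "(real^'m) \<times> real" and t :: real
      assume P: "P \<in> W_set - V_set D g" and Q: "Q \<in> W_set - V_set D g" and t: "0 \<le> t \<and> t \<le> 1"
      obtain x a y b where xy: "P = (x, a)" "Q = (y, b)" by fastforce
      have "Phi g ((1 - t) *\<^sub>R x + t *\<^sub>R y) \<le> (1 - t) * Phi g x + t * Phi g y"
        using conv t by (simp add: convex_on_def)
      also have "\<dots> \<le> (1 - t) * a + t * b"
        using P Q t unfolding xy mem by (intro add_mono mult_left_mono) auto
      finally have 1: "Phi g ((1 - t) *\<^sub>R x + t *\<^sub>R y) \<le> (1 - t) * a + t * b" .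
      have eq: "(norm ((1 - t) *\<^sub>R x + t *\<^sub>R y))\<^sup>2 / 2
          = (1 - t) * ((norm x)\<^sup>2 / 2) + t * ((norm y)\<^sup>2 / 2) - t * (1 - t) * (norm (x - y))\<^sup>2 / 2"
        unfolding power2_norm_eq_inner
        by (simp add: inner_add_left inner_add_right inner_diff_left inner_diff_right inner_commute)
           (simp add: algebra_simps)
      have "0 \<le> t * (1 - t) * (norm (x - y))\<^sup>2 / 2" using t by simp
      moreover have "(1 - t) * ((norm x)\<^sup>2 / 2) + t * ((norm y)\<^sup>2 / 2) < (1 - t) * a + t * b"
      proof (cases "t = 0")
        case True
        then show ?thesis using P unfolding xy mem by simp
      next
        case False
        then show ?thesis using P Q t unfolding xy mem
          by (intro add_le_less_mono mult_left_mono mult_strict_left_mono) auto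
      qed
      ultimately have "(norm ((1 - t) *\<^sub>R x + t *\<^sub>R y))\<^sup>2 / 2 < (1 - t) * a + t * b"
        unfolding eq by linarith
      with 1 show "(1 - t) *\<^sub>R P + t *\<^sub>R Q \<in> W_set - V_set D g"
        unfolding xy by (simp add: mem del: Diff_iff)
    qed
  }
qed

text \<open>
  With \<open>k = g u\<close>, \<open>l = g x\<close> and \<open>y = x - u\<close>, the hypothesis bounds \<open>k * (grad g u \<bullet> y)\<close> by
  \<open>(y \<bullet> y + l\<^sup>2 - k\<^sup>2) / 2\<close>. Multiplied by \<open>2 * (k - b)\<close> it gives the tangent inequality of \<open>Phi_c g a b\<close>,
  multiplied by \<open>2 * k\<close>, with the surplus \<open>b * (y \<bullet> y + (l - k)\<^sup>2)\<close>, which is positive.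
  Geometrically, shrinking a touching ball towards its point of contact leaves no other point of
  contact.
\<close>

lemma Phi_c_strict_gradient_ineq:
  assumes "tangent_supported" "0 < b" "b < g u" "b < g x" "x \<noteq> u"
  shows "Phi_c g a b u + (u - a + (g u - b) *\<^sub>R grad g u) \<bullet> (x - u) < Phi_c g a b x"
proof -
  define y where "y = x - u"
  define m where "m = grad g u \<bullet> y"
  define k where "k = g u"
  define l where "l = g x"
  have "u \<in> D" using assms mem_D_iff by auto
  have x: "x = u + y" by (simp add: y_def)
  have k: "0 < k" "b < k" using assms by (auto simp: k_def)
  have y: "0 < y \<bullet> y" using assms by (simp add: y_def)
  have "Phi g u + foot g u \<bullet> y \<le> Phi g x" using assms(1) \<open>u \<in> D\<close> by (simp add: tangent_supported_def y_def)
  then have km: "k * m \<le> (y \<bullet> y + l\<^sup>2 - k\<^sup>2) / 2"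
    unfolding Phi_def foot_def power2_norm_eq_inner k_def[symmetric] l_def[symmetric]
    unfolding x by (simp add: inner_add_left inner_add_right inner_commute m_def field_simps)
  have "(k - b) * (2 * (k * m)) \<le> (k - b) * (y \<bullet> y + l\<^sup>2 - k\<^sup>2)"
    using km k by (intro mult_left_mono) auto
  moreover have "0 < b * (y \<bullet> y + (l - k)\<^sup>2)" using assms y by (simp add: add_pos_nonneg)
  ultimately have "k * ((k - b)\<^sup>2 + 2 * ((k - b) * m)) < k * (y \<bullet> y + (l - b)\<^sup>2)"
    by (simp add: algebra_simps power2_eq_square)
  then have "(k - b)\<^sup>2 + 2 * ((k - b) * m) < y \<bullet> y + (l - b)\<^sup>2" using k by simp
  then show ?thesis
    unfolding Phi_c_def power2_norm_eq_inner k_def[symmetric] l_def[symmetric]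
    unfolding x by (simp add: inner_add_left inner_add_right inner_diff_left inner_diff_right
        inner_commute m_def field_simps)
qed

lemma tangent_supported_imp_Phi_c_strictly_convex:
  assumes "tangent_supported"
  shows "\<forall>a b. b > 0 \<longrightarrow>
    (\<forall>S. convex_subdomain S {u \<in> D. g u > b} \<longrightarrow> strictly_convex_on S (Phi_c g a b))"
proof (intro allI impI)
  fix a b S assume "(0::real) < b" and S: "convex_subdomain S {u \<in> D. g u > b}"
  show "strictly_convex_on S (Phi_c g a b)"
  proof (rule strictly_convex_onI_gradient)
    show "convex S" using S by (simp add: convex_subdomain_def)
  next
    fix x y assume "x \<in> S" "y \<in> S" "y \<noteq> x"
    then show "Phi_c g a b x + (x - a + (g x - b) *\<^sub>R grad g x) \<bullet> (y - x) < Phi_c g a b y"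
      using S \<open>0 < b\<close> by (intro Phi_c_strict_gradient_ineq assms) (auto simp: convex_subdomain_def)
  qed
qed

text \<open>
  On a small ball around \<open>u\<close> the height \<open>g\<close> stays above \<open>g u / 2\<close>, and there \<open>Phi g\<close> is the
  pointwise limit of \<open>Phi_c g 0 b\<close> as \<open>b\<close> decreases to 0.
\<close>

lemma Phi_c_convex_imp_second_order:
  assumes "\<forall>a b. b > 0 \<longrightarrow>
    (\<forall>S. convex_subdomain S {u \<in> D. g u > b} \<longrightarrow> convex_on S (Phi_c g a b))"
  shows "second_order_convex"
proof (rule second_order_if_locally_convex)
  fix u assume "u \<in> D"
  define b0 where "b0 = g u / 2"
  have "0 < b0" using g_pos[OF \<open>u \<in> D\<close>] by (simp add: b0_def)
  have "open {x. b0 < g x}" using continuous_on_g by (intro open_Collect_less) auto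
  moreover have "u \<in> {x. b0 < g x}" using \<open>0 < b0\<close> by (simp add: b0_def)
  ultimately obtain r where r: "0 < r" "convex_subdomain (ball u r) {x. b0 < g x}"
    using small_convex_subdomain by blast
  have gt: "b0 < g x" if "x \<in> ball u r" for x using r(2) that by (auto simp: convex_subdomain_def)
  then have sub: "ball u r \<subseteq> D" using \<open>0 < b0\<close> mem_D_iff by force
  have "convex_on (ball u r) (Phi g)"
  proof (rule convex_onI)
    fix t :: real and x y assume *: "0 < t" "t < 1" "x \<in> ball u r" "y \<in> ball u r"
    have "\<forall>\<^sub>F b in at_right 0. b \<in> {0<..<b0}" using \<open>0 < b0\<close> by (rule eventually_at_right_real)
    then have ev: "\<forall>\<^sub>F b in at_right 0. Phi_c g 0 b ((1 - t) *\<^sub>R x + t *\<^sub>R y)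
        \<le> (1 - t) * Phi_c g 0 b x + t * Phi_c g 0 b y"
    proof eventually_elim
      case (elim b)
      have "convex_subdomain (ball u r) {u \<in> D. g u > b}"
        using r(1) sub gt elim by (force simp: convex_subdomain_def)
      then have "convex_on (ball u r) (Phi_c g 0 b)" using assms elim by auto
      then show ?case using * by (simp add: convex_on_def)
    qed
    have lim: "((\<lambda>b. Phi_c g 0 b z) \<longlongrightarrow> Phi g z) (at_right 0)" for z
    proof -
      have "((\<lambda>b. Phi_c g 0 b z) \<longlongrightarrow> ((norm (z - 0))\<^sup>2 + (g z - 0)\<^sup>2) / 2) (at_right 0)"
        unfolding Phi_c_def by (intro tendsto_intros) auto
      then show ?thesis by (simp add: Phi_def)
    qed
    show "Phi g ((1 - t) *\<^sub>R x + t *\<^sub>R y) \<le> (1 - t) * Phi g x + t * Phi g y"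
      by (rule tendsto_le[OF _ _ lim ev]) (auto intro!: tendsto_intros lim)
  qed simp
  then show "\<exists>r>0. ball u r \<subseteq> D \<and> convex_on (ball u r) (Phi g)" using r(1) sub by blast
qed

end

section \<open>Touching balls and nearest points\<close>

text \<open>
  Shrinking a ball towards a point \<open>y\<close> of its boundary moves all other boundary points into the open
  larger ball: with \<open>w = z - y\<close> both distance conditions are linear in \<open>w \<bullet> n\<close>.
\<close>

lemma inner_tangent_ball:
  fixes y n z :: "'a::real_inner"
  assumes "0 < t" "t < T" "dist (y + t *\<^sub>R n) z \<le> t * norm n" "z \<noteq> y"
  shows "dist (y + T *\<^sub>R n) z < T * norm n"
proof -
  define w where "w = z - y"
  have w: "0 < w \<bullet> w" using assms(4) by (simp add: w_def)
  have d: "(dist (y + r *\<^sub>R n) z)\<^sup>2 = w \<bullet> w - 2 * r * (w \<bullet> n) + (r * norm n)\<^sup>2" for r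
  proof -
    have "dist (y + r *\<^sub>R n) z = norm (r *\<^sub>R n - w)" by (simp add: dist_norm w_def algebra_simps)
    then show ?thesis
      by (simp add: power2_norm_eq_inner power_mult_distrib inner_diff_left inner_diff_right
          inner_commute) (simp add: power2_eq_square)
  qed
  have "(dist (y + t *\<^sub>R n) z)\<^sup>2 \<le> (t * norm n)\<^sup>2"
    using assms(3) by (rule power_mono) simp
  then have 1: "w \<bullet> w \<le> 2 * t * (w \<bullet> n)" unfolding d by simp
  then have "0 < 2 * t * (w \<bullet> n)" using w by linarith
  then have "0 < w \<bullet> n" using assms(1) by (simp add: zero_less_mult_iff)
  then have "t * (w \<bullet> n) < T * (w \<bullet> n)" using assms(2) by simp
  then have "(dist (y + T *\<^sub>R n) z)\<^sup>2 < (T * norm n)\<^sup>2" unfolding d using 1 by simp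
  then show ?thesis by (rule power2_less_imp_less) (use assms(1,2) in simp)
qed

lemma ball_subset_if_frontier_far:
  fixes c :: "'a::real_normed_vector"
  assumes "c \<in> S" "\<And>z. z \<in> frontier S \<Longrightarrow> \<rho> \<le> dist c z"
  shows "ball c \<rho> \<subseteq> S"
proof (cases "0 < \<rho>")
  case True
  show ?thesis
  proof (rule ccontr)
    assume "\<not> ball c \<rho> \<subseteq> S"
    moreover have "c \<in> ball c \<rho> \<inter> S" using True assms(1) by simp
    ultimately have "ball c \<rho> \<inter> frontier S \<noteq> {}"
      by (intro connected_Int_frontier connected_ball) blast+
    then show False using assms(2) by force
  qed
qed (simp add: ball_empty)

lemma le_infdist_iff:
  assumes "A \<noteq> {}"
  shows "r \<le> infdist x A \<longleftrightarrow> (\<forall>a\<in>A. r \<le> dist x a)"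
proof
  show "\<forall>a\<in>A. r \<le> dist x a \<Longrightarrow> r \<le> infdist x A"
    unfolding infdist_notempty[OF assms] using assms by (intro cINF_greatest) auto
qed (meson infdist_le order_trans)

lemma nearest_iff_le_infdist:
  assumes "y \<in> F"
  shows "(\<forall>w\<in>F. dist x y \<le> dist x w) \<longleftrightarrow> dist x y \<le> infdist x F"
  using assms by (subst le_infdist_iff) auto

text \<open>
  The classical argument of Motzkin, with Brouwer's fixed point theorem. If each point \<open>z\<close>
  near \<open>x\<close> has exactly one nearest point \<open>P z\<close> in \<open>F\<close>, then \<open>P\<close> is continuous, and the map sending \<open>z\<close>
  to the point at distance \<open>\<epsilon>\<close> from \<open>x\<close> in the direction \<open>x - P z\<close> has a fixed point. At a
  fixed point \<open>z\<close>, the point \<open>x\<close> lies between \<open>z\<close> and \<open>P z\<close>, so \<open>P z\<close> is also nearest to \<open>x\<close>.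
  Thus the point nearest to \<open>x\<close> remains nearest when \<open>x\<close> moves straight away from it.
\<close>

lemma unique_nearest_extends:
  fixes F :: "'a::euclidean_space set"
  assumes "closed F" "0 < \<epsilon>" "x \<notin> F"
    and unique: "\<And>z. z \<in> cball x \<epsilon> \<Longrightarrow> \<exists>!y. y \<in> F \<and> (\<forall>w\<in>F. dist z y \<le> dist z w)"
    and y0: "y0 \<in> F" "\<forall>w\<in>F. dist x y0 \<le> dist x w"
  shows "\<forall>w\<in>F. dist (x + (\<epsilon> / dist x y0) *\<^sub>R (x - y0)) y0 \<le> dist (x + (\<epsilon> / dist x y0) *\<^sub>R (x - y0)) w"
proof -
  define P where "P z = (THE y. y \<in> F \<and> (\<forall>w\<in>F. dist z y \<le> dist z w))" for z
  have P: "P z \<in> F" "\<And>w. w \<in> F \<Longrightarrow> dist z (P z) \<le> dist z w" if "z \<in> cball x \<epsilon>" for z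
    using theI'[OF unique[OF that]] unfolding P_def by auto
  have P_eq: "P z = y" if "z \<in> cball x \<epsilon>" "y \<in> F" "\<forall>w\<in>F. dist z y \<le> dist z w" for z y
    unfolding P_def using unique[OF that(1)] that by (intro the1_equality) auto
  define f where "f z = x + (\<epsilon> / norm (x - P z)) *\<^sub>R (x - P z)" for z
  have x_ne: "x \<noteq> P z" if "z \<in> cball x \<epsilon>" for z using P(1)[OF that] assms(3) by auto
  have "continuous_on (cball x \<epsilon>) P"
  proof (rule continuous_from_closed_graph)
    \<comment> \<open>A compact target, so that a closed graph gives continuity.\<close>
    define K where "K = F \<inter> cball x (\<epsilon> + (\<epsilon> + dist x y0))"
    show "compact K" unfolding K_def using assms(1) by (intro closed_Int_compact) auto
    show PK: "P \<in> cball x \<epsilon> \<rightarrow> K"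
    proof
      fix z assume z: "z \<in> cball x \<epsilon>"
      have "dist x (P z) \<le> dist x z + dist z (P z)" by (rule dist_triangle)
      also have "\<dots> \<le> \<epsilon> + dist z y0" using z P(2)[OF z y0(1)] by auto
      also have "\<dots> \<le> \<epsilon> + (\<epsilon> + dist x y0)" using z dist_triangle3[of z y0 x] by auto
      finally show "P z \<in> K" using P(1)[OF z] by (simp add: K_def)
    qed
    have "(\<lambda>z. (z, P z)) ` cball x \<epsilon>
        = (cball x \<epsilon> \<times> F) \<inter> {p. dist (fst p) (snd p) \<le> infdist (fst p) F}"
      using P P_eq by (auto simp: image_iff simp flip: nearest_iff_le_infdist)
    moreover have "closed {p :: 'a \<times> 'a. dist (fst p) (snd p) \<le> infdist (fst p) F}"
      by (intro closed_Collect_le continuous_intros)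
    ultimately show "closed ((\<lambda>z. (z, P z)) ` cball x \<epsilon>)"
      using assms(1) by (auto intro!: closed_Int closed_Times)
  qed
  then have "continuous_on (cball x \<epsilon>) f"
    unfolding f_def using x_ne by (intro continuous_intros) auto
  moreover have norm_f: "dist x (f z) = \<epsilon>" if "z \<in> cball x \<epsilon>" for z
    using x_ne[OF that] assms(2) by (simp add: f_def dist_norm)
  ultimately obtain z where z: "z \<in> cball x \<epsilon>" "f z = z"
    using brouwer_ball[OF \<open>0 < \<epsilon>\<close>, of x f] by force
  have zx: "dist x z = \<epsilon>" using norm_f[OF z(1)] z(2) by simp
  have split: "dist z (P z) = \<epsilon> + dist x (P z)"
  proof -
    have "z - P z = (1 + \<epsilon> / norm (x - P z)) *\<^sub>R (x - P z)"
      using z(2) by (simp add: f_def algebra_simps)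
    moreover have "norm (x - P z) > 0" using x_ne[OF z(1)] by simp
    ultimately show ?thesis using assms(2)
      by (simp add: dist_norm distrib_right add_pos_pos abs_of_pos)
  qed
  have "dist x (P z) \<le> dist x w" if "w \<in> F" for w
    using P(2)[OF z(1) that] split dist_triangle[of z w x] zx by (simp add: dist_commute)
  then have "P z = P x" using P(1)[OF z(1)] assms(2) by (intro P_eq[symmetric]) auto
  also have "P x = y0" using y0 assms(2) by (intro P_eq) auto
  finally have "P z = y0" .
  then have "z = x + (\<epsilon> / dist x y0) *\<^sub>R (x - y0)" using z(2) by (simp add: f_def dist_norm)
  then show ?thesis using P(2)[OF z(1)] \<open>P z = y0\<close> by auto
qed

context graph_domain
begin

section \<open>Inscribed balls as affine minorants\<close>

lemma mem_Omega_iff: "(x, v) \<in> Omega D g \<longleftrightarrow> \<bar>v\<bar> < g x"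
  by (auto simp: Omega_def mem_D_iff)

lemma open_Omega: "open (Omega D g)"
proof -
  have "Omega D g = {z. \<bar>snd z\<bar> < g (fst z)}" using mem_Omega_iff by auto
  moreover have "open {z. \<bar>snd z\<bar> < g (fst z)}"
    by (intro open_Collect_less continuous_intros continuous_on_compose2[OF continuous_on_g]) auto
  ultimately show ?thesis by simp
qed

lemma frontier_Omega_imp:
  assumes "(x, v) \<in> frontier (Omega D g)"
  shows "\<bar>v\<bar> = g x"
proof -
  have "closed {z. \<bar>snd z\<bar> \<le> g (fst z)}"
    by (intro closed_Collect_le continuous_intros continuous_on_compose2[OF continuous_on_g]) auto
  moreover have "Omega D g \<subseteq> {z. \<bar>snd z\<bar> \<le> g (fst z)}" using mem_Omega_iff by auto
  ultimately have "closure (Omega D g) \<subseteq> {z. \<bar>snd z\<bar> \<le> g (fst z)}" by (rule closure_minimal[rotated])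
  then have "\<bar>v\<bar> \<le> g x" using assms by (auto simp: frontier_def)
  moreover have "\<not> \<bar>v\<bar> < g x"
    using assms open_Omega by (auto simp: frontier_def interior_open mem_Omega_iff)
  ultimately show ?thesis by simp
qed

lemma graph_in_frontier:
  assumes "u \<in> D"
  shows "(u, g u) \<in> frontier (Omega D g)"
proof -
  have "(u, g u) \<in> closure (Omega D g)"
    unfolding closure_approachable
  proof (intro allI impI)
    fix e :: real assume "0 < e"
    define v where "v = g u - min (e / 2) (g u)"
    have "(u, v) \<in> Omega D g" "dist (u, v) (u, g u) < e"
      using g_pos[OF assms] \<open>0 < e\<close> by (auto simp: mem_Omega_iff v_def dist_Pair_Pair dist_real_def)
    then show "\<exists>y\<in>Omega D g. dist y (u, g u) < e" by blast
  qed
  then show ?thesis using open_Omega by (auto simp: frontier_def interior_open mem_Omega_iff)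
qed

lemma upper_frontier_iff:
  "y \<in> upper (frontier (Omega D g)) \<longleftrightarrow> (\<exists>u\<in>D. y = (u, g u))"
  using frontier_Omega_imp graph_in_frontier mem_D_iff by (cases y) (force simp: upper_def)

text \<open>
  In the coordinates \<open>x\<close> and \<open>((norm x)\<^sup>2 + v\<^sup>2) / 2\<close>, balls centered on the hyperplane become half
  spaces below the graphs of affine functions, and \<open>Omega D g\<close> becomes the region below \<open>Phi g\<close>. This
  is the dictionary between geometry and convexity.
\<close>

lemma mem_ball_Pair_iff:
  assumes "0 \<le> \<rho>"
  shows "(x, v) \<in> ball (a, 0) \<rho> \<longleftrightarrow> ((norm x)\<^sup>2 + v\<^sup>2) / 2 < a \<bullet> x + (\<rho>\<^sup>2 - (norm a)\<^sup>2) / 2"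
proof -
  have "(x, v) \<in> ball (a, 0) \<rho> \<longleftrightarrow> (dist (a, 0) (x, v))\<^sup>2 < \<rho>\<^sup>2"
    using assms by (auto intro: power_strict_mono power2_less_imp_less)
  also have "(dist (a, 0) (x, v))\<^sup>2 = (norm (a - x))\<^sup>2 + v\<^sup>2"
    by (simp add: dist_Pair_Pair flip: dist_norm)
  also have "(norm (a - x))\<^sup>2 = (norm a)\<^sup>2 - 2 * (a \<bullet> x) + (norm x)\<^sup>2"
    by (simp add: power2_norm_eq_inner inner_diff_left inner_diff_right inner_commute)
  finally show ?thesis by (auto simp: field_simps)
qed

lemma ball_subset_Omega_iff:
  assumes "0 \<le> \<rho>"
  shows "ball (a, 0) \<rho> \<subseteq> Omega D g \<longleftrightarrow> (\<forall>x. a \<bullet> x + (\<rho>\<^sup>2 - (norm a)\<^sup>2) / 2 \<le> Phi g x)"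
proof
  assume sub: "ball (a, 0) \<rho> \<subseteq> Omega D g"
  show "\<forall>x. a \<bullet> x + (\<rho>\<^sup>2 - (norm a)\<^sup>2) / 2 \<le> Phi g x"
  proof (rule allI, rule ccontr)
    fix x assume "\<not> a \<bullet> x + (\<rho>\<^sup>2 - (norm a)\<^sup>2) / 2 \<le> Phi g x"
    then have "(x, g x) \<in> ball (a, 0) \<rho>" using assms by (simp add: mem_ball_Pair_iff Phi_def del: mem_ball)
    then show False using sub by (auto simp: mem_Omega_iff)
  qed
next
  assume below: "\<forall>x. a \<bullet> x + (\<rho>\<^sup>2 - (norm a)\<^sup>2) / 2 \<le> Phi g x"
  show "ball (a, 0) \<rho> \<subseteq> Omega D g"
  proof (rule subsetI, clarify)
    fix x :: "real^'m" and v :: real assume "(x, v) \<in> ball (a, 0) \<rho>"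
    then have "((norm x)\<^sup>2 + v\<^sup>2) / 2 < Phi g x"
      unfolding mem_ball_Pair_iff[OF assms] using below[rule_format, of x] by linarith
    then have "\<bar>v\<bar>\<^sup>2 < (g x)\<^sup>2" by (simp add: Phi_def)
    then show "(x, v) \<in> Omega D g" using g_nonneg mem_Omega_iff power2_less_imp_less by blast
  qed
qed

lemma normal_length_nonneg: "0 \<le> normal_length g u"
  by (simp add: normal_length_def g_nonneg)

lemma foot_ball_affine:
  "foot g u \<bullet> x + ((normal_length g u)\<^sup>2 - (norm (foot g u))\<^sup>2) / 2 = Phi g u + foot g u \<bullet> (x - u)"
proof -
  have "(normal_length g u)\<^sup>2 = (g u)\<^sup>2 * (1 + grad g u \<bullet> grad g u)"
    by (simp add: normal_length_def power_mult_distrib power2_norm_eq_inner add_nonneg_nonneg)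
  then show ?thesis
    unfolding Phi_def foot_def power2_norm_eq_inner
    by (simp add: inner_add_left inner_add_right inner_diff_right inner_commute field_simps
        power2_eq_square)
qed

lemma tangent_supported_iff_foot_balls:
  "tangent_supported \<longleftrightarrow> (\<forall>u\<in>D. ball (foot g u, 0) (normal_length g u) \<subseteq> Omega D g)"
  by (simp add: tangent_supported_def ball_subset_Omega_iff normal_length_nonneg foot_ball_affine)

lemma Omega_subset_foot_balls:
  "Omega D g \<subseteq> (\<Union>u\<in>D. ball (foot g u, 0) (normal_length g u))"
proof (rule subsetI, clarify)
  fix x v assume v: "(x, v) \<in> Omega D g"
  then have "\<bar>v\<bar>\<^sup>2 < (g x)\<^sup>2" by (intro power_strict_mono) (auto simp: mem_Omega_iff)
  then have "(x, v) \<in> ball (foot g x, 0) (normal_length g x)"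
    by (simp add: mem_ball_Pair_iff normal_length_nonneg foot_ball_affine Phi_def del: mem_ball)
  moreover have "x \<in> D" using v by (simp add: Omega_def)
  ultimately show "(x, v) \<in> (\<Union>u\<in>D. ball (foot g u, 0) (normal_length g u))" by blast
qed

lemma foot_ball_cover_iff:
  "Omega D g = (\<Union>u\<in>D. ball (foot g u, 0) (normal_length g u)) \<longleftrightarrow> tangent_supported"
  using Omega_subset_foot_balls unfolding tangent_supported_iff_foot_balls by blast

lemma foot_in_D:
  assumes "tangent_supported" "u \<in> D"
  shows "foot g u \<in> D"
proof -
  have "0 < normal_length g u"
    using g_pos[OF assms(2)] by (simp add: normal_length_def add_pos_nonneg)
  then have "(foot g u, 0) \<in> Omega D g"
    using assms unfolding tangent_supported_iff_foot_balls by (auto simp: subset_eq)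
  then show ?thesis by (simp add: Omega_def)
qed

text \<open>
  Around each point of \<open>D\<close> take the largest ball in \<open>Omega D g\<close>. Since foot points lie in \<open>D\<close>, these
  balls contain the foot point balls, which already cover.
\<close>

lemma centered_ball_cover:
  assumes "tangent_supported"
  shows "\<exists>r. (\<forall>u\<in>D. 0 < r u) \<and> Omega D g = (\<Union>u\<in>D. ball (u, 0) (r u))"
proof (cases "D = {}")
  case True
  then show ?thesis by (auto simp: Omega_def)
next
  case False
  define r where "r u = infdist (u, 0::real) (- Omega D g)" for u :: "real^'m"
  have ne: "- Omega D g \<noteq> {}"
  proof -
    have "(u, g u) \<in> - Omega D g" for u by (simp add: mem_Omega_iff)
    then show ?thesis by blast
  qed
  have pos: "0 < r u" if "u \<in> D" for u
    unfolding r_def using open_Omega ne that g_pos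
    by (intro infdist_pos_not_in_closed) (auto simp: mem_Omega_iff)
  have sub: "ball (u, 0) (r u) \<subseteq> Omega D g" for u :: "real^'m"
  proof
    fix z :: "(real^'m) \<times> real" assume "z \<in> ball (u, 0) (r u)"
    then show "z \<in> Omega D g" using infdist_le[of z "- Omega D g" "(u, 0)"] by (force simp: r_def)
  qed
  have "ball (foot g u, 0) (normal_length g u) \<subseteq> (\<Union>u\<in>D. ball (u, 0) (r u))" if "u \<in> D" for u
  proof -
    have "ball (foot g u, 0) (normal_length g u) \<subseteq> Omega D g"
      using assms that by (auto simp: tangent_supported_iff_foot_balls)
    then have "normal_length g u \<le> dist (foot g u, 0) z" if "z \<notin> Omega D g" for z
      using that by (meson mem_ball not_le subsetD)
    then have "normal_length g u \<le> r (foot g u)"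
      unfolding r_def le_infdist_iff[OF ne] by blast
    then have "ball (foot g u, 0) (normal_length g u) \<subseteq> ball (foot g u, 0) (r (foot g u))"
      by (rule subset_ball)
    then show ?thesis using foot_in_D[OF assms that] by blast
  qed
  then have "(\<Union>u\<in>D. ball (foot g u, 0) (normal_length g u)) \<subseteq> (\<Union>u\<in>D. ball (u, 0) (r u))"
    by (rule UN_least)
  with Omega_subset_foot_balls have "Omega D g \<subseteq> (\<Union>u\<in>D. ball (u, 0) (r u))"
    by (rule order_trans)
  moreover have "(\<Union>u\<in>D. ball (u, 0) (r u)) \<subseteq> Omega D g" using sub by (rule UN_least)
  ultimately show ?thesis using pos by (intro exI[of _ r]) auto
qed

text \<open>
  Inscribed balls are affine minorants of \<open>Phi g\<close>, and covering the point \<open>(x, v)\<close> with \<open>v\<close> close to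
  \<open>g x\<close> makes the minorant at \<open>x\<close> close to \<open>Phi g x\<close>.
\<close>

lemma inscribed_balls_imp_convex:
  assumes "\<And>x v. (x, v) \<in> Omega D g \<Longrightarrow> \<exists>a \<rho>. 0 \<le> \<rho> \<and> (x, v) \<in> ball (a, 0) \<rho> \<and> ball (a, 0) \<rho> \<subseteq> Omega D g"
  shows "convex_on UNIV (Phi g)"
proof (rule convex_on_UNIV_Phi_if_minorants)
  fix x and e :: real assume "x \<in> D" "0 < e"
  \<comment> \<open>Chosen so that the loss \<open>((g x)\<^sup>2 - v\<^sup>2) / 2\<close> is at most \<open>e / 2\<close>.\<close>
  define v where "v = sqrt (max 0 ((g x)\<^sup>2 - e))"
  have "0 < (g x)\<^sup>2" using g_pos[OF \<open>x \<in> D\<close>] by simp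
  then have v: "(g x)\<^sup>2 - e \<le> v\<^sup>2" "v\<^sup>2 < (g x)\<^sup>2" "0 \<le> v" using \<open>0 < e\<close> by (auto simp: v_def)
  then have "v < g x" using g_nonneg by (blast intro: power2_less_imp_less)
  then have "(x, v) \<in> Omega D g" using v by (simp add: mem_Omega_iff)
  then obtain a \<rho> where "0 \<le> \<rho>" "(x, v) \<in> ball (a, 0) \<rho>" "ball (a, 0) \<rho> \<subseteq> Omega D g"
    using assms by blast
  then have *: "((norm x)\<^sup>2 + v\<^sup>2) / 2 < a \<bullet> x + (\<rho>\<^sup>2 - (norm a)\<^sup>2) / 2"
    "\<And>y. a \<bullet> y + (\<rho>\<^sup>2 - (norm a)\<^sup>2) / 2 \<le> Phi g y"
    using mem_ball_Pair_iff ball_subset_Omega_iff by blast+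
  have "Phi g x - e < ((norm x)\<^sup>2 + v\<^sup>2) / 2" using v \<open>0 < e\<close> by (simp add: Phi_def field_simps)
  with *(1) have "Phi g x < a \<bullet> x + (\<rho>\<^sup>2 - (norm a)\<^sup>2) / 2 + e" by linarith
  with *(2) show "\<exists>a c. (\<forall>y. a \<bullet> y + c \<le> Phi g y) \<and> Phi g x < a \<bullet> x + c + e"
    by (intro exI[of _ a] exI[of _ "(\<rho>\<^sup>2 - (norm a)\<^sup>2) / 2"] conjI allI)
qed

lemma centered_ball_cover_imp_convex:
  assumes "\<forall>u\<in>D. 0 < r u" "Omega D g = (\<Union>u\<in>D. ball (u, 0) (r u))"
  shows "convex_on UNIV (Phi g)"
proof (rule inscribed_balls_imp_convex)
  fix x v assume "(x, v) \<in> Omega D g"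
  then obtain u where u: "u \<in> D" "(x, v) \<in> ball (u, 0) (r u)" unfolding assms(2) by blast
  then have "ball (u, 0) (r u) \<subseteq> Omega D g" unfolding assms(2) by blast
  moreover have "0 \<le> r u" using assms(1) u(1) by (simp add: less_imp_le)
  ultimately show "\<exists>a \<rho>. 0 \<le> \<rho> \<and> (x, v) \<in> ball (a, 0) \<rho> \<and> ball (a, 0) \<rho> \<subseteq> Omega D g"
    using u(2) by (intro exI[of _ u] exI[of _ "r u"] conjI)
qed

lemma dist_foot_graph: "dist (foot g u, 0) (u, g u) = normal_length g u"
proof -
  have "dist (foot g u) u = g u * norm (grad g u)"
    by (simp add: dist_norm foot_def g_nonneg)
  then have "(dist (foot g u, 0) (u, g u))\<^sup>2 = (normal_length g u)\<^sup>2"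
    by (simp add: dist_Pair_Pair normal_length_def power_mult_distrib
        add_nonneg_nonneg algebra_simps)
  then show ?thesis using normal_length_nonneg by (simp add: power2_eq_iff_nonneg)
qed

lemma tangent_supported_imp_graph_nearest:
  assumes "tangent_supported"
  shows "\<forall>y\<in>upper (frontier (Omega D g)). \<exists>u\<in>D.
       \<forall>z\<in>frontier (Omega D g). dist (u, 0) y \<le> dist (u, 0) z"
proof
  fix y assume "y \<in> upper (frontier (Omega D g))"
  then obtain u where u: "u \<in> D" "y = (u, g u)" by (auto simp: upper_frontier_iff)
  have "normal_length g u \<le> dist (foot g u, 0) z" if "z \<in> frontier (Omega D g)" for z
  proof -
    have "z \<notin> Omega D g" using that open_Omega by (simp add: frontier_def interior_open)
    then show ?thesis using assms u(1) by (force simp: tangent_supported_iff_foot_balls subset_eq)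
  qed
  then show "\<exists>u\<in>D. \<forall>z\<in>frontier (Omega D g). dist (u, 0) y \<le> dist (u, 0) z"
    using foot_in_D[OF assms u(1)] by (auto simp: u(2) dist_foot_graph intro!: bexI[of _ "foot g u"])
qed

lemma graph_nearest_imp_convex:
  assumes "\<forall>y\<in>upper (frontier (Omega D g)). \<exists>u\<in>D.
       \<forall>z\<in>frontier (Omega D g). dist (u, 0) y \<le> dist (u, 0) z"
  shows "convex_on UNIV (Phi g)"
proof (rule inscribed_balls_imp_convex)
  fix x v assume v: "(x, v) \<in> Omega D g"
  then have "(x, g x) \<in> upper (frontier (Omega D g))"
    unfolding upper_frontier_iff by (auto simp: Omega_def)
  then obtain a where a: "a \<in> D"
    "\<And>z. z \<in> frontier (Omega D g) \<Longrightarrow> dist (a, 0) (x, g x) \<le> dist (a, 0) z"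
    using assms by blast
  have "(a, 0) \<in> Omega D g" using g_pos[OF a(1)] by (simp add: mem_Omega_iff)
  then have "ball (a, 0) (dist (a, 0) (x, g x)) \<subseteq> Omega D g"
    using a(2) by (rule ball_subset_if_frontier_far)
  moreover have "(x, v) \<in> ball (a, 0) (dist (a, 0) (x, g x))"
  proof -
    have "\<bar>v\<bar>\<^sup>2 < (g x)\<^sup>2" using v by (intro power_strict_mono) (auto simp: mem_Omega_iff)
    then show ?thesis by (simp add: dist_Pair_Pair)
  qed
  ultimately show "\<exists>a \<rho>. 0 \<le> \<rho> \<and> (x, v) \<in> ball (a, 0) \<rho> \<and> ball (a, 0) \<rho> \<subseteq> Omega D g"
    using zero_le_dist by blast
qed

section \<open>Nearest points and normals\<close>

definition normal_point :: "real^'m \<Rightarrow> real \<Rightarrow> (real^'m) \<times> real" where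
  "normal_point u t = (u, g u) + t *\<^sub>R (grad g u, -1)"

abbreviation normal_norm :: "real^'m \<Rightarrow> real" where
  "normal_norm u \<equiv> norm (grad g u, -1::real)"

lemma normal_point_Pair: "normal_point u t = (u + t *\<^sub>R grad g u, g u - t)"
  by (simp add: normal_point_def)

lemma normal_norm_pos: "0 < normal_norm u"
  by (simp add: zero_prod_def)

lemma normal_point_foot: "normal_point u (g u) = (foot g u, 0)"
  by (simp add: normal_point_Pair foot_def)

lemma normal_length_eq: "normal_length g u = g u * normal_norm u"
  by (simp add: normal_length_def norm_Pair add.commute)

lemma normal_segment_iff: "x \<in> normal_segment g u \<longleftrightarrow> (\<exists>t. 0 < t \<and> t < g u \<and> x = normal_point u t)"
  by (auto simp: normal_segment_def normal_point_def)

lemma dist_normal_point: "0 \<le> t \<Longrightarrow> dist (normal_point u t) (u, g u) = t * normal_norm u"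
  unfolding normal_point_def dist_norm add_diff_cancel_left' norm_scaleR by simp

definition nearest :: "(real^'m) \<times> real \<Rightarrow> (real^'m) \<times> real \<Rightarrow> bool" where
  "nearest x y \<longleftrightarrow> y \<in> frontier (Omega D g) \<and> (\<forall>z\<in>frontier (Omega D g). dist x y \<le> dist x z)"

lemma nearest_exists:
  assumes "x \<in> upper (Omega D g)"
  obtains y where "nearest x y"
proof -
  have "fst x \<in> D" using assms by (auto simp: upper_def Omega_def)
  then have "frontier (Omega D g) \<noteq> {}" using graph_in_frontier by blast
  from distance_attains_inf[OF frontier_closed this, of x] show ?thesis
    using that unfolding nearest_def by metis
qed

text \<open>
  The open ball around \<open>x\<close> that reaches to a nearest point lies in \<open>Omega D g\<close>. It contains the points
  vertically above or below the nearest point whose height is closer to that of \<open>x\<close>; for a nearest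
  point on or below the hyperplane these would include points outside \<open>Omega D g\<close>. So the nearest
  point is on the graph, and there the first order condition puts \<open>x\<close> on the normal.
\<close>

lemma nearest_is_normal:
  assumes x: "x \<in> upper (Omega D g)" and y: "nearest x y"
  obtains u t where "u \<in> D" "0 < t" "t < g u" "y = (u, g u)" "x = normal_point u t"
    "ball x (t * normal_norm u) \<subseteq> Omega D g"
proof -
  obtain a h where xa: "x = (a, h)" by fastforce
  obtain u v where yu: "y = (u, v)" by fastforce
  have h: "0 < h" "(a, h) \<in> Omega D g" using x xa by (auto simp: upper_def)
  have ball: "ball x (dist x y) \<subseteq> Omega D g"
    using y h xa by (intro ball_subset_if_frontier_far) (auto simp: nearest_def)
  have v: "\<bar>v\<bar> = g u" using y frontier_Omega_imp by (simp add: nearest_def yu)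
  have closer: "\<bar>w\<bar> < g u" if "\<bar>w - h\<bar> < \<bar>v - h\<bar>" for w
  proof -
    have "\<bar>w - h\<bar>\<^sup>2 < \<bar>v - h\<bar>\<^sup>2" using that by (intro power_strict_mono) auto
    then have "(u, w) \<in> ball x (dist x y)"
      by (simp add: xa yu dist_Pair_Pair dist_real_def power2_commute)
    then show ?thesis using ball mem_Omega_iff by blast
  qed
  have v_eq: "v = g u"
  proof (rule ccontr)
    assume "v \<noteq> g u"
    then have "v = - g u" "0 < g u" using v by linarith+
    then have "\<bar>g u - h\<bar> < \<bar>v - h\<bar>" using h(1) by linarith
    then show False using closer[of "g u"] by simp
  qed
  have "0 < v"
  proof (rule ccontr)
    assume "\<not> 0 < v"
    then have "v = 0" using v v_eq by simp
    then show False using closer[of h] h v_eq by simp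
  qed
  then have u: "u \<in> D" using v_eq mem_D_iff by simp
  \<comment> \<open>The squared distance from \<open>x\<close> to the graph has a minimum at \<open>u\<close>.\<close>
  define F where "F w = (norm (a - w))\<^sup>2 + (h - g w)\<^sup>2" for w
  have F: "F w = (dist x (w, g w))\<^sup>2" for w
    by (simp add: F_def xa dist_Pair_Pair dist_real_def flip: dist_norm)
  have "F u \<le> F w" if "w \<in> D" for w
    using y graph_in_frontier[OF that] unfolding F nearest_def yu v_eq by (intro power_mono) auto
  moreover have "(F has_derivative (\<lambda>k. - 2 * ((a - u + (h - g u) *\<^sub>R grad g u) \<bullet> k))) (at u)"
    unfolding F_def[abs_def] power2_norm_eq_inner
    by (auto intro!: derivative_eq_intros g_has_derivative[OF u]
        simp: fun_eq_iff inner_add_left inner_add_right inner_diff_left inner_diff_right inner_commute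
          algebra_simps)
  ultimately have "(\<lambda>k. - 2 * ((a - u + (h - g u) *\<^sub>R grad g u) \<bullet> k)) = (\<lambda>k. 0)"
    using differential_zero_maxmin[OF u open_D] by blast
  then have "(a - u + (h - g u) *\<^sub>R grad g u) \<bullet> (a - u + (h - g u) *\<^sub>R grad g u) = 0"
    by (simp add: fun_eq_iff)
  then have "a - u + (h - g u) *\<^sub>R grad g u = 0" by (simp only: inner_eq_zero_iff)
  then have a: "a = u + (g u - h) *\<^sub>R grad g u" by (simp add: algebra_simps)
  have x_eq: "x = normal_point u (g u - h)" by (simp add: normal_point_Pair xa a)
  have "h < g u"
  proof (rule ccontr)
    assume "\<not> h < g u"
    moreover have "h \<noteq> g u" using a h mem_Omega_iff by auto
    ultimately show False using closer[of h] v_eq \<open>0 < v\<close> h by simp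
  qed
  then have "dist x y = (g u - h) * normal_norm u"
    using dist_normal_point[of "g u - h" u] x_eq yu v_eq by simp
  then show ?thesis
    using that[of u "g u - h"] u h \<open>h < g u\<close> yu v_eq x_eq ball by simp
qed

lemma graph_strictly_nearest:
  assumes "tangent_supported" "u \<in> D" "0 < t" "t < g u" "z \<notin> Omega D g" "z \<noteq> (u, g u)"
  shows "dist (normal_point u t) (u, g u) < dist (normal_point u t) z"
proof (rule ccontr)
  assume "\<not> ?thesis"
  then have "dist ((u, g u) + t *\<^sub>R (grad g u, -1)) z \<le> t * normal_norm u"
    using dist_normal_point[of t u] assms(3) by (simp add: normal_point_def)
  from inner_tangent_ball[OF assms(3,4) this assms(6)]
  have "z \<in> ball (foot g u, 0) (normal_length g u)"
    using normal_point_foot[of u] by (simp add: normal_length_eq normal_point_def)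
  then show False using assms(1,2,5) unfolding tangent_supported_iff_foot_balls by blast
qed

lemma frontier_not_Omega: "z \<in> frontier (Omega D g) \<Longrightarrow> z \<notin> Omega D g"
  using open_Omega by (simp add: frontier_def interior_open)

lemma graph_not_Omega: "(u, g u) \<notin> Omega D g"
  by (simp add: mem_Omega_iff)

lemma tangent_supported_imp_unique_nearest:
  assumes "tangent_supported"
  shows "\<forall>x\<in>upper (Omega D g). \<exists>!y. y \<in> upper (frontier (Omega D g)) \<and>
       (\<forall>z\<in>upper (frontier (Omega D g)). dist x y \<le> dist x z)"
proof
  fix x assume x: "x \<in> upper (Omega D g)"
  then obtain y where y: "nearest x y" using nearest_exists by blast
  obtain u t where u: "u \<in> D" "0 < t" "t < g u" "y = (u, g u)" "x = normal_point u t"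
    using nearest_is_normal[OF x y] by metis
  show "\<exists>!y. y \<in> upper (frontier (Omega D g)) \<and>
       (\<forall>z\<in>upper (frontier (Omega D g)). dist x y \<le> dist x z)"
  proof (rule ex1I[of _ y])
    show "y \<in> upper (frontier (Omega D g)) \<and> (\<forall>z\<in>upper (frontier (Omega D g)). dist x y \<le> dist x z)"
      using y u by (auto simp: upper_frontier_iff nearest_def graph_in_frontier)
  next
    fix y' assume y': "y' \<in> upper (frontier (Omega D g)) \<and>
      (\<forall>z\<in>upper (frontier (Omega D g)). dist x y' \<le> dist x z)"
    have "dist x y' \<le> dist x y" using y' u by (auto simp: upper_frontier_iff)
    moreover have "y' \<notin> Omega D g" using y' frontier_not_Omega by (auto simp: upper_def)
    ultimately show "y' = y"
      using graph_strictly_nearest[OF assms u(1-3), of y'] u(4,5) by force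
  qed
qed

lemma tangent_supported_imp_normals_disjoint:
  assumes "tangent_supported"
  shows "\<forall>u\<in>D. \<forall>u'\<in>D. u \<noteq> u' \<longrightarrow> normal_segment g u \<inter> normal_segment g u' = {}"
proof (intro ballI impI equals0I)
  fix u u' x assume *: "u \<in> D" "u' \<in> D" "u \<noteq> u'" "x \<in> normal_segment g u \<inter> normal_segment g u'"
  then obtain t t' where t: "0 < t" "t < g u" "x = normal_point u t"
    "0 < t'" "t' < g u'" "x = normal_point u' t'" by (auto simp: normal_segment_iff)
  then have "dist x (u, g u) < dist x (u', g u')" "dist x (u', g u') < dist x (u, g u)"
    using graph_strictly_nearest[OF assms *(1), of t "(u', g u')"]
      graph_strictly_nearest[OF assms *(2), of t' "(u, g u)"] *(3) graph_not_Omega by auto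
  then show False by simp
qed

section \<open>Enlarging touching balls\<close>

text \<open>
  A ball in \<open>Omega D g\<close> that touches the graph over \<open>u\<close> and is centered in the upper half space can be
  enlarged while touching at the same point. Disjoint normals and unique nearest points both imply
  this, for different reasons.
\<close>

definition ball_extension :: bool where
  "ball_extension \<longleftrightarrow> (\<forall>u\<in>D. \<forall>t. 0 < t \<and> t < g u \<and> ball (normal_point u t) (t * normal_norm u) \<subseteq> Omega D g \<longrightarrow>
      (\<exists>s>t. s < g u \<and> ball (normal_point u s) (s * normal_norm u) \<subseteq> Omega D g))"

text \<open>
  The admissible parameters have a supremum, which is itself admissible because each point of the
  open ball at the supremum lies in balls for slightly smaller parameters. By the extension property
  it cannot be less than \<open>g u\<close>.
\<close>

lemma extended_ball_reaches_foot:
  assumes "ball_extension" "u \<in> D" "0 < t" "t < g u"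
    "ball (normal_point u t) (t * normal_norm u) \<subseteq> Omega D g"
  shows "ball (foot g u, 0) (normal_length g u) \<subseteq> Omega D g"
proof -
  define T where "T = {s. 0 < s \<and> s \<le> g u \<and> ball (normal_point u s) (s * normal_norm u) \<subseteq> Omega D g}"
  have "t \<in> T" using assms by (simp add: T_def)
  have bdd: "bdd_above T" unfolding T_def by (rule bdd_aboveI[of _ "g u"]) auto
  define S where "S = Sup T"
  have "t \<le> S" unfolding S_def using \<open>t \<in> T\<close> bdd by (rule cSup_upper)
  have "S \<le> g u" unfolding S_def using \<open>t \<in> T\<close> by (intro cSup_least) (auto simp: T_def)
  have ball_S: "ball (normal_point u S) (S * normal_norm u) \<subseteq> Omega D g"
  proof
    fix z assume "z \<in> ball (normal_point u S) (S * normal_norm u)"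
    then have z: "dist (normal_point u S) z - S * normal_norm u < 0" by simp
    have "isCont (\<lambda>s. dist (normal_point u s) z - s * normal_norm u) S"
      unfolding normal_point_def by (intro continuous_intros)
    then have "\<forall>\<^sub>F s in at_left S. dist (normal_point u s) z - s * normal_norm u < 0"
      using z by (intro order_tendstoD(2)[of _ "dist (normal_point u S) z - S * normal_norm u"])
        (auto simp: isCont_def filterlim_at_split)
    from this[unfolded eventually_at_left_field] obtain b where b: "b < S" "\<And>s. b < s \<Longrightarrow> s < S \<Longrightarrow> dist (normal_point u s) z - s * normal_norm u < 0"
      by blast
    obtain s where s: "s \<in> T" "b < s"
      using less_cSup_iff[of T b] \<open>t \<in> T\<close> bdd b(1) unfolding S_def by blast
    have "s \<le> S" unfolding S_def using s(1) bdd by (rule cSup_upper)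
    then have "z \<in> ball (normal_point u s) (s * normal_norm u)"
      using b(2)[of s] s(2) z by (cases "s = S") auto
    then show "z \<in> Omega D g" using s(1) by (auto simp: T_def)
  qed
  have "S = g u"
  proof (rule ccontr)
    assume "S \<noteq> g u"
    then have "0 < S" "S < g u" using assms(3) \<open>t \<le> S\<close> \<open>S \<le> g u\<close> by linarith+
    then obtain s where "S < s" "s < g u" "ball (normal_point u s) (s * normal_norm u) \<subseteq> Omega D g"
      using assms(1,2) ball_S unfolding ball_extension_def by blast
    then have "s \<in> T" using assms(3) \<open>t \<le> S\<close> by (simp add: T_def)
    then have "s \<le> S" unfolding S_def using bdd by (rule cSup_upper)
    then show False using \<open>S < s\<close> by simp
  qed
  then show ?thesis using ball_S normal_point_foot normal_length_eq by simp
qed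

text \<open>
  Some touching ball is needed to start the extension. Points of \<open>Omega D g\<close> just below the graph
  over \<open>u\<close> have nearest points close to \<open>(u, g u)\<close>, so touching balls exist over a dense set of
  \<open>D\<close>. As the tangent planes of \<open>Phi g\<close> depend continuously on the point of contact, a dense set
  suffices.
\<close>

lemma tangent_supported_if_ball_extension:
  assumes "ball_extension"
  shows "tangent_supported"
  unfolding tangent_supported_def
proof (intro ballI allI, rule ccontr)
  fix u x assume u: "u \<in> D" and neg: "\<not> Phi g u + foot g u \<bullet> (x - u) \<le> Phi g x"
  define f where "f w = Phi g w + foot g w \<bullet> (x - w)" for w
  have "isCont (foot g) u" using foot_has_derivative[OF u] has_derivative_continuous by blast
  moreover have "isCont (Phi g) u" using continuous_on_Phi by (simp add: continuous_on_eq_continuous_at)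
  ultimately have "isCont f u" unfolding f_def by (intro continuous_intros)
  then have "(f \<longlongrightarrow> f u) (nhds u)" by (simp add: isCont_def tendsto_at_iff_tendsto_nhds)
  then have "\<forall>\<^sub>F w in nhds u. Phi g x < f w"
    by (rule order_tendstoD(1)) (use neg in \<open>simp add: f_def\<close>)
  then obtain \<rho> where \<rho>: "0 < \<rho>" "\<And>w. dist w u < \<rho> \<Longrightarrow> Phi g x < f w"
    unfolding eventually_nhds_metric by blast
  define \<epsilon> where "\<epsilon> = min (\<rho> / 3) (g u / 2)"
  have e: "0 < \<epsilon>" "\<epsilon> < g u" "2 * \<epsilon> < \<rho>" using \<rho>(1) g_pos[OF u] by (auto simp: \<epsilon>_def)
  define q where "q = (u, g u - \<epsilon>)"
  have q: "q \<in> upper (Omega D g)" using e by (auto simp: q_def upper_def mem_Omega_iff)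
  then obtain y where y: "nearest q y" using nearest_exists by blast
  obtain u' t where u': "u' \<in> D" "0 < t" "t < g u'" "y = (u', g u')" "q = normal_point u' t"
    "ball q (t * normal_norm u') \<subseteq> Omega D g"
    using nearest_is_normal[OF q y] by metis
  have "dist q y \<le> dist q (u, g u)" using y graph_in_frontier[OF u] by (simp add: nearest_def)
  also have "\<dots> = \<epsilon>" using e by (simp add: q_def dist_Pair_Pair dist_real_def)
  finally have "dist u' u \<le> \<epsilon>"
    using dist_fst_le[of q y] by (simp add: q_def u'(4) dist_commute)
  then have "Phi g x < f u'" using \<rho>(2)[of u'] e by simp
  moreover have "ball (foot g u', 0) (normal_length g u') \<subseteq> Omega D g"
    using extended_ball_reaches_foot[OF assms u'(1-3)] u'(5,6) by simp
  then have "f u' \<le> Phi g x"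
    by (simp add: ball_subset_Omega_iff normal_length_nonneg foot_ball_affine f_def)
  ultimately show False by simp
qed

lemma normal_point_in_upper:
  assumes "0 < t" "t < g u" "ball (normal_point u t) (t * normal_norm u) \<subseteq> Omega D g"
  shows "normal_point u t \<in> upper (Omega D g)"
proof -
  have "0 < t * normal_norm u" using assms(1) normal_norm_pos by simp
  then have "normal_point u t \<in> Omega D g" using assms(3) by (meson centre_in_ball subsetD)
  then show ?thesis using assms(2) by (simp add: upper_def normal_point_Pair)
qed

lemma open_upper_Omega: "open (upper (Omega D g))"
proof -
  have "{(u, v). 0 < v} = {z :: (real^'m) \<times> real. 0 < snd z}" by auto
  moreover have "open \<dots>" by (intro open_Collect_less continuous_intros)
  ultimately show ?thesis unfolding upper_def using open_Omega by (simp add: open_Int)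
qed

text \<open>
  Move the center \<open>normal_point u t\<close> slightly further along the normal. Its nearest point lies over
  some \<open>u'\<close>, and then the new center is on the normals of both \<open>u\<close> and \<open>u'\<close>; hence \<open>u' = u\<close>.
\<close>

lemma normals_disjoint_imp_ball_extension:
  assumes disj: "\<forall>u\<in>D. \<forall>u'\<in>D. u \<noteq> u' \<longrightarrow> normal_segment g u \<inter> normal_segment g u' = {}"
  shows "ball_extension"
  unfolding ball_extension_def
proof (intro ballI allI impI, elim conjE)
  fix u t assume u: "u \<in> D" and t: "0 < t" "t < g u"
    and "ball (normal_point u t) (t * normal_norm u) \<subseteq> Omega D g"
  then have "normal_point u t \<in> upper (Omega D g)" by (intro normal_point_in_upper)
  moreover have "isCont (normal_point u) t" unfolding normal_point_def by (intro continuous_intros)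
  ultimately have "\<forall>\<^sub>F s in at_right t. normal_point u s \<in> upper (Omega D g)"
    using open_upper_Omega by (auto simp: isCont_def filterlim_at_split intro: topological_tendstoD)
  moreover have "\<forall>\<^sub>F s in at_right t. s \<in> {t<..<g u}" using t(2) by (rule eventually_at_right_real)
  ultimately have "\<forall>\<^sub>F s in at_right t. normal_point u s \<in> upper (Omega D g) \<and> s \<in> {t<..<g u}"
    by (rule eventually_conj)
  then obtain s where s: "normal_point u s \<in> upper (Omega D g)" "t < s" "s < g u"
    using eventually_happens[of _ "at_right t"] by force
  then obtain y where "nearest (normal_point u s) y" using nearest_exists by blast
  then obtain u' t' where u': "u' \<in> D" "0 < t'" "t' < g u'" "normal_point u s = normal_point u' t'"
    "ball (normal_point u s) (t' * normal_norm u') \<subseteq> Omega D g"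
    using nearest_is_normal[OF s(1)] by metis
  then have "normal_point u s \<in> normal_segment g u \<inter> normal_segment g u'"
    using s t by (auto simp: normal_segment_iff intro: less_trans)
  then have "u' = u" using disj u u'(1) by blast
  then have "t' = s" using u'(4) by (simp add: normal_point_Pair)
  then show "\<exists>s>t. s < g u \<and> ball (normal_point u s) (s * normal_norm u) \<subseteq> Omega D g"
    using u'(5) \<open>u' = u\<close> s by blast
qed

lemma unique_nearest_imp_ball_extension:
  assumes uniq: "\<forall>x\<in>upper (Omega D g). \<exists>!y. y \<in> upper (frontier (Omega D g)) \<and>
       (\<forall>z\<in>upper (frontier (Omega D g)). dist x y \<le> dist x z)"
  shows "ball_extension"
  unfolding ball_extension_def
proof (intro ballI allI impI, elim conjE)
  fix u t assume u: "u \<in> D" and t: "0 < t" "t < g u"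
    and ball: "ball (normal_point u t) (t * normal_norm u) \<subseteq> Omega D g"
  define F where "F = frontier (Omega D g)"
  define x where "x = normal_point u t"
  define l where "l = normal_norm u"
  have l: "0 < l" unfolding l_def by (rule normal_norm_pos)
  have x: "x \<in> upper (Omega D g)" unfolding x_def using t ball by (rule normal_point_in_upper)
  then obtain \<epsilon> where \<epsilon>: "0 < \<epsilon>" "cball x \<epsilon> \<subseteq> upper (Omega D g)"
    using open_upper_Omega open_contains_cball by blast
  have unique: "\<exists>!y. y \<in> F \<and> (\<forall>w\<in>F. dist z y \<le> dist z w)" if "z \<in> cball x \<epsilon>" for z
  proof -
    have z: "z \<in> upper (Omega D g)" using that \<epsilon> by blast
    have *: "y \<in> upper F \<and> (\<forall>w\<in>upper F. dist z y \<le> dist z w)" if near: "nearest z y" for y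
    proof -
      obtain u where "u \<in> D" "y = (u, g u)" using nearest_is_normal[OF z near] by metis
      then show ?thesis using near upper_frontier_iff unfolding F_def nearest_def
        by (auto simp: upper_def)
    qed
    obtain y where "nearest z y" using nearest_exists[OF z] by blast
    moreover have "y' = y" if "nearest z y'" for y'
      using * that \<open>nearest z y\<close> uniq z unfolding F_def by blast
    ultimately show ?thesis unfolding nearest_def F_def by blast
  qed
  have y0: "(u, g u) \<in> F" unfolding F_def using u by (rule graph_in_frontier)
  have dxy: "dist x (u, g u) = t * l" using t by (simp add: x_def l_def dist_normal_point)
  have near: "\<forall>w\<in>F. dist x (u, g u) \<le> dist x w"
  proof
    fix w assume "w \<in> F"
    then have "w \<notin> Omega D g" unfolding F_def by (rule frontier_not_Omega)
    then have "w \<notin> ball x (t * l)" using ball by (auto simp: x_def l_def)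
    then show "dist x (u, g u) \<le> dist x w" by (simp add: dxy)
  qed
  have "x \<notin> F" using x frontier_not_Omega by (auto simp: F_def upper_def)
  \<comment> \<open>Moving by \<open>\<epsilon>\<close> away from \<open>(u, g u)\<close> advances the parameter of the normal by \<open>\<epsilon> / l\<close>.\<close>
  define s where "s = t + \<epsilon> / l"
  have z: "x + (\<epsilon> / dist x (u, g u)) *\<^sub>R (x - (u, g u)) = normal_point u s"
    unfolding dxy using t l by (simp add: x_def normal_point_Pair s_def algebra_simps)
  have nz: "\<forall>w\<in>F. dist (normal_point u s) (u, g u) \<le> dist (normal_point u s) w"
    using unique_nearest_extends[OF _ \<epsilon>(1) \<open>x \<notin> F\<close> unique y0 near] unfolding z
    by (simp add: F_def)
  have "t < s" using \<epsilon>(1) l by (simp add: s_def)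
  have "normal_point u s - x = (\<epsilon> / l) *\<^sub>R (grad g u, -1)"
    by (simp add: normal_point_def x_def s_def algebra_simps)
  then have "norm (normal_point u s - x) = \<bar>\<epsilon> / l\<bar> * l" by (simp only: norm_scaleR l_def)
  then have "dist x (normal_point u s) = \<epsilon>" using l \<epsilon>(1)
    by (simp add: dist_norm norm_minus_commute[of x])
  then have zin: "normal_point u s \<in> upper (Omega D g)" using \<epsilon> by auto
  have "ball (normal_point u s) (s * l) \<subseteq> Omega D g"
  proof (rule ball_subset_if_frontier_far)
    show "normal_point u s \<in> Omega D g" using zin by (simp add: upper_def)
    fix w assume "w \<in> frontier (Omega D g)"
    then show "s * l \<le> dist (normal_point u s) w"
      using nz dist_normal_point[of s u] \<open>t < s\<close> t by (simp add: F_def l_def)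
  qed
  moreover have "s < g u" using zin by (simp add: upper_def normal_point_Pair)
  ultimately show "\<exists>s>t. s < g u \<and> ball (normal_point u s) (s * normal_norm u) \<subseteq> Omega D g"
    using \<open>t < s\<close> unfolding l_def by blast
qed

end

section \<open>Principal curvatures\<close>

text \<open>
  Vectors on which a nonnegative quadratic form vanishes lie in the kernel. This is how a minimizer
  of a Rayleigh quotient becomes an eigenvector.
\<close>

lemma selfadjoint_nonneg_kernel:
  fixes A :: "'a::real_inner \<Rightarrow> 'a"
  assumes "linear A" and adj: "\<And>x y. x \<bullet> A y = A x \<bullet> y" and nonneg: "\<And>x. 0 \<le> x \<bullet> A x"
    and null: "x \<bullet> A x = 0"
  shows "A x = 0"
proof (rule ccontr)
  interpret linear A by fact
  define z where "z = A x"
  define c where "c = z \<bullet> A z"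
  have c: "0 \<le> c" unfolding c_def by (rule nonneg)
  assume "A x \<noteq> 0"
  then have zz: "0 < z \<bullet> z" by (simp add: z_def)
  have "x \<bullet> A z = z \<bullet> z" using adj[of x z] by (simp add: z_def)
  moreover have "z \<bullet> A x = z \<bullet> z" by (simp add: z_def)
  ultimately have expand: "(x + s *\<^sub>R z) \<bullet> A (x + s *\<^sub>R z) = s * (2 * (z \<bullet> z) + s * c)" for s
    using null by (simp add: add scale inner_add_left inner_add_right c_def algebra_simps)
  \<comment> \<open>With this \<open>s\<close> the linear term outweighs the quadratic one; adding 1 to \<open>c\<close> avoids division by 0.\<close>
  have "s * (2 * (z \<bullet> z) + s * c) < 0" if "s = - (z \<bullet> z) / (c + 1)" for s
  proof -
    have "s < 0" unfolding that using zz c by (simp add: divide_neg_pos)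
    have "s * (c + 1) = - (z \<bullet> z)" unfolding that using c by simp
    then have "s * c = - (z \<bullet> z) - s" by (simp add: algebra_simps)
    then have "0 < 2 * (z \<bullet> z) + s * c" using zz \<open>s < 0\<close> by linarith
    with \<open>s < 0\<close> show ?thesis by (rule mult_neg_pos)
  qed
  then show False using nonneg expand by (metis not_le)
qed

lemma semicircle_parametrization:
  fixes a e :: "'a::real_normed_vector" and r :: real
  assumes "0 < r"
  shows "{(a + (r * cos \<theta>) *\<^sub>R e, r * sin \<theta>) | \<theta>. 0 < \<theta> \<and> \<theta> < pi}
       = (\<lambda>\<rho>. (a + \<rho> *\<^sub>R e, sqrt (r\<^sup>2 - \<rho>\<^sup>2))) ` {-r<..<r}"
proof (intro equalityI subsetI)
  fix z assume "z \<in> {(a + (r * cos \<theta>) *\<^sub>R e, r * sin \<theta>) | \<theta>. 0 < \<theta> \<and> \<theta> < pi}"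
  then obtain \<theta> where \<theta>: "z = (a + (r * cos \<theta>) *\<^sub>R e, r * sin \<theta>)" "0 < \<theta>" "\<theta> < pi" by blast
  have sin: "0 < sin \<theta>" using \<theta> by (intro sin_gt_zero)
  have eq: "r\<^sup>2 - (r * cos \<theta>)\<^sup>2 = (r * sin \<theta>)\<^sup>2"
    by (simp add: power_mult_distrib sin_squared_eq right_diff_distrib)
  have "0 < (r * sin \<theta>)\<^sup>2" using sin assms by simp
  then have "(r * cos \<theta>)\<^sup>2 < r\<^sup>2" using eq by linarith
  then have "\<bar>r * cos \<theta>\<bar>\<^sup>2 < r\<^sup>2" by simp
  then have "\<bar>r * cos \<theta>\<bar> < r" using assms by (simp add: power2_less_imp_less)
  then have "r * cos \<theta> \<in> {-r<..<r}" by (auto simp: abs_less_iff)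
  moreover have "z = (a + (r * cos \<theta>) *\<^sub>R e, sqrt (r\<^sup>2 - (r * cos \<theta>)\<^sup>2))"
    unfolding eq \<theta>(1) using sin assms by simp
  ultimately show "z \<in> (\<lambda>\<rho>. (a + \<rho> *\<^sub>R e, sqrt (r\<^sup>2 - \<rho>\<^sup>2))) ` {-r<..<r}" by blast
next
  fix z assume "z \<in> (\<lambda>\<rho>. (a + \<rho> *\<^sub>R e, sqrt (r\<^sup>2 - \<rho>\<^sup>2))) ` {-r<..<r}"
  then obtain \<rho> where \<rho>: "-r < \<rho>" "\<rho> < r" "z = (a + \<rho> *\<^sub>R e, sqrt (r\<^sup>2 - \<rho>\<^sup>2))" by auto
  define \<theta> where "\<theta> = arccos (\<rho> / r)"
  have b: "-1 < \<rho> / r" "\<rho> / r < 1" using \<rho> assms by (simp_all add: field_simps)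
  have "0 < \<theta>" "\<theta> < pi" using arccos_lt_bounded[OF b] by (simp_all add: \<theta>_def)
  moreover have "r * cos \<theta> = \<rho>" using b assms by (simp add: \<theta>_def)
  moreover have "r * sin \<theta> = sqrt (r\<^sup>2 - \<rho>\<^sup>2)"
  proof -
    have "r * sin \<theta> = sqrt (r\<^sup>2) * sqrt (1 - (\<rho> / r)\<^sup>2)"
      using b assms by (simp add: \<theta>_def sin_arccos)
    also have "\<dots> = sqrt (r\<^sup>2 * (1 - (\<rho> / r)\<^sup>2))" by (simp only: real_sqrt_mult)
    also have "r\<^sup>2 * (1 - (\<rho> / r)\<^sup>2) = r\<^sup>2 - \<rho>\<^sup>2" using assms by (simp add: field_simps power2_eq_square)
    finally show ?thesis .
  qed
  ultimately show "z \<in> {(a + (r * cos \<theta>) *\<^sub>R e, r * sin \<theta>) | \<theta>. 0 < \<theta> \<and> \<theta> < pi}"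
    using \<rho>(3) by force
qed

context graph_domain
begin

abbreviation normal_factor :: "real^'m \<Rightarrow> real" where
  "normal_factor u \<equiv> 1 / sqrt (1 + (norm (grad g u))\<^sup>2)"

lemma graph_point_has_derivative:
  "u \<in> D \<Longrightarrow> (graph_point g has_derivative (\<lambda>h. (h, grad g u \<bullet> h))) (at u)"
  unfolding graph_point_def[abs_def] by (intro has_derivative_Pair g_has_derivative) auto

lemma first_form_eq:
  "u \<in> D \<Longrightarrow> first_form g u \<zeta> \<xi> = \<zeta> \<bullet> \<xi> + (grad g u \<bullet> \<zeta>) * (grad g u \<bullet> \<xi>)"
  by (simp add: first_form_def flip: frechet_derivative_at[OF graph_point_has_derivative])

text \<open>
  The derivative of the factor normalizing the normal contributes only a multiple of the normal,
  which is orthogonal to the tangent vectors.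
\<close>

lemma second_form_eq:
  assumes "u \<in> D"
  shows "second_form g u \<zeta> \<xi> = normal_factor u * (\<zeta> \<bullet> (hessian g u *v \<xi>))"
proof -
  have "(\<lambda>x. 1 + (norm (grad g x))\<^sup>2) differentiable (at u)"
    unfolding power2_norm_eq_inner differentiable_def
    using grad_has_derivative[OF assms] by (auto intro!: exI derivative_eq_intros)
  moreover have "(\<lambda>t. 1 / sqrt t) differentiable (at (1 + (norm (grad g u))\<^sup>2))"
  proof -
    have "0 < 1 + (norm (grad g u))\<^sup>2" by (simp add: add_pos_nonneg)
    then show ?thesis unfolding real_differentiable_def
      by (auto intro!: exI derivative_eq_intros)
  qed
  ultimately have "normal_factor differentiable (at u)"
    using differentiable_chain_at[of "\<lambda>x. 1 + (norm (grad g x))\<^sup>2" u "\<lambda>t. 1 / sqrt t"] by (simp add: o_def)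
  then obtain w' where w': "(normal_factor has_derivative w') (at u)"
    by (auto simp: differentiable_def)
  have "((\<lambda>x. (grad g x, -1::real)) has_derivative (\<lambda>h. (hessian g u *v h, 0))) (at u)"
    by (intro has_derivative_Pair grad_has_derivative assms) auto
  from has_derivative_scaleR[OF w' this]
  have "(unit_normal g has_derivative
      (\<lambda>h. normal_factor u *\<^sub>R (hessian g u *v h, 0) + w' h *\<^sub>R (grad g u, -1))) (at u)"
    unfolding unit_normal_def[abs_def] .
  from frechet_derivative_at[OF this]
  have "second_form g u \<zeta> \<xi> = (\<zeta>, grad g u \<bullet> \<zeta>) \<bullet>
      (normal_factor u *\<^sub>R (hessian g u *v \<xi>, 0) + w' \<xi> *\<^sub>R (grad g u, -1))"
    unfolding second_form_def
    by (simp add: fun_eq_iff flip: frechet_derivative_at[OF graph_point_has_derivative[OF assms]])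
  then show ?thesis
    by (simp add: inner_add_right inner_commute algebra_simps)
qed

lemma first_form_nondegenerate:
  assumes "u \<in> D" "\<And>\<zeta>. first_form g u \<zeta> \<xi> = first_form g u \<zeta> \<xi>'"
  shows "\<xi> = \<xi>'"
proof -
  define d where "d = \<xi> - \<xi>'"
  have "d \<bullet> d + (grad g u \<bullet> d) * (grad g u \<bullet> d) = 0"
    using assms(2)[of d] by (simp add: first_form_eq[OF assms(1)] d_def inner_diff_right algebra_simps)
  then have "d \<bullet> d = 0" by (smt (verit) inner_ge_zero zero_le_square)
  then show ?thesis by (simp add: d_def)
qed

text \<open>
  The first form has the matrix of the identity plus a rank one term, so its inverse is explicit
  (Sherman-Morrison), and with it the operator.
\<close>

lemma shape_operator_works:
  assumes "u \<in> D"
  shows "first_form g u \<zeta> (shape_operator g u \<xi>) = second_form g u \<zeta> \<xi>"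
proof -
  define C where "C \<xi> = normal_factor u *\<^sub>R (hessian g u *v \<xi>
      - ((grad g u \<bullet> (hessian g u *v \<xi>)) / (1 + grad g u \<bullet> grad g u)) *\<^sub>R grad g u)" for \<xi>
  have "linear C"
    unfolding C_def
    by (intro linearI) (simp_all add: matrix_vector_right_distrib matrix_vector_mult_scaleR
        inner_add_right add_divide_distrib scaleR_left.add algebra_simps)
  moreover have "first_form g u \<zeta> (C \<xi>) = second_form g u \<zeta> \<xi>" for \<zeta> \<xi>
  proof -
    define k where "k = (grad g u \<bullet> (hessian g u *v \<xi>)) / (1 + grad g u \<bullet> grad g u)"
    have "0 < 1 + grad g u \<bullet> grad g u" by (simp add: add_pos_nonneg)
    then have k: "k * (1 + grad g u \<bullet> grad g u) = grad g u \<bullet> (hessian g u *v \<xi>)" by (simp add: k_def)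
    have "first_form g u \<zeta> (C \<xi>) = normal_factor u * (\<zeta> \<bullet> (hessian g u *v \<xi>)
        + (grad g u \<bullet> \<zeta>) * (grad g u \<bullet> (hessian g u *v \<xi>) - k * (1 + grad g u \<bullet> grad g u)))"
      unfolding first_form_eq[OF assms] C_def k_def[symmetric]
      by (simp add: inner_diff_right inner_commute algebra_simps)
    then show ?thesis by (simp add: k second_form_eq[OF assms])
  qed
  ultimately have "\<exists>!C. linear C \<and> (\<forall>\<zeta> \<xi>. first_form g u \<zeta> (C \<xi>) = second_form g u \<zeta> \<xi>)"
    by (intro ex1I[of _ C]) (auto intro!: ext first_form_nondegenerate[OF assms])
  from theI'[OF this] show ?thesis unfolding shape_operator_def by blast
qed

lemma principal_curvature_iff:
  assumes "u \<in> D"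
  shows "principal_curvature g u \<kappa> \<longleftrightarrow>
    (\<exists>\<xi>. \<xi> \<noteq> 0 \<and> (\<forall>\<zeta>. second_form g u \<zeta> \<xi> = \<kappa> * first_form g u \<zeta> \<xi>))"
proof -
  have "shape_operator g u \<xi> = \<kappa> *\<^sub>R \<xi> \<longleftrightarrow> (\<forall>\<zeta>. second_form g u \<zeta> \<xi> = \<kappa> * first_form g u \<zeta> \<xi>)" for \<xi>
  proof -
    have scale: "first_form g u \<zeta> (\<kappa> *\<^sub>R \<xi>) = \<kappa> * first_form g u \<zeta> \<xi>" for \<zeta>
      by (simp add: first_form_eq[OF assms] algebra_simps)
    show ?thesis
      using first_form_nondegenerate[OF assms, of "shape_operator g u \<xi>" "\<kappa> *\<^sub>R \<xi>"]
      by (metis scale shape_operator_works[OF assms])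
  qed
  then show ?thesis by (simp add: principal_curvature_def)
qed

lemma tangent_form_eq:
  assumes "u \<in> D"
  shows "tangent_form u x = first_form g u x x + normal_length g u * second_form g u x x"
proof -
  have "0 < sqrt (1 + (norm (grad g u))\<^sup>2)" by (simp add: add_pos_nonneg)
  then have "normal_length g u * normal_factor u = g u" by (simp add: normal_length_def)
  then have "normal_length g u * (normal_factor u * h) = g u * h" for h
    by (simp only: flip: mult.assoc)
  then show ?thesis
    unfolding tangent_form_def first_form_eq[OF assms] second_form_eq[OF assms]
    by (simp only: power2_eq_square)
qed

lemma first_form_pos:
  assumes "u \<in> D" "x \<noteq> 0"
  shows "0 < first_form g u x x"
  using assms by (simp add: first_form_eq add_pos_nonneg)

text \<open>
  The least value \<open>\<kappa>\<close> of the quotient of the second by the first form is attained on the unit sphere.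
  The form \<open>second - \<kappa> * first\<close> is then nonnegative and vanishes at the minimizer, which is
  therefore a principal direction.
\<close>

lemma exists_least_principal_curvature:
  assumes "u \<in> D"
  obtains \<kappa> where "principal_curvature g u \<kappa>" "\<And>x. \<kappa> * first_form g u x x \<le> second_form g u x x"
proof -
  define R where "R x = second_form g u x x / first_form g u x x" for x
  have "continuous_on (sphere 0 1) R"
    unfolding R_def[abs_def]
  proof (intro continuous_on_divide ballI)
    show "continuous_on (sphere 0 1) (\<lambda>x. second_form g u x x)"
      unfolding second_form_eq[OF assms] by (intro continuous_intros matrix_vector_mult_linear_continuous_on)
    show "continuous_on (sphere 0 1) (\<lambda>x. first_form g u x x)"
      unfolding first_form_eq[OF assms] by (intro continuous_intros)
    show "first_form g u x x \<noteq> 0" if "x \<in> sphere 0 1" for x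
      using first_form_pos[OF assms, of x] that by fastforce
  qed
  moreover have "sphere (0::real^'m) 1 \<noteq> {}" by simp
  ultimately obtain x0 where x0: "x0 \<in> sphere 0 1" "\<And>x. x \<in> sphere 0 1 \<Longrightarrow> R x0 \<le> R x"
    using continuous_attains_inf[OF compact_sphere] by metis
  define \<kappa> where "\<kappa> = R x0"
  have bound: "\<kappa> * first_form g u x x \<le> second_form g u x x" for x
  proof (cases "x = 0")
    case False
    define c where "c = 1 / norm x"
    have c: "0 < c" using False by (simp add: c_def)
    have "c *\<^sub>R x \<in> sphere 0 1" using False by (simp add: c_def)
    then have "\<kappa> \<le> R (c *\<^sub>R x)" unfolding \<kappa>_def by (rule x0(2))
    also have "R (c *\<^sub>R x) = (c\<^sup>2 * second_form g u x x) / (c\<^sup>2 * first_form g u x x)"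
      by (simp add: R_def first_form_eq second_form_eq assms matrix_vector_mult_scaleR
          power2_eq_square algebra_simps)
    also have "\<dots> = second_form g u x x / first_form g u x x" using c by simp
    finally show ?thesis using first_form_pos[OF assms False] by (simp add: field_simps)
  qed (simp add: first_form_eq second_form_eq assms)
  define A where "A x = normal_factor u *\<^sub>R (hessian g u *v x) - \<kappa> *\<^sub>R (x + (grad g u \<bullet> x) *\<^sub>R grad g u)" for x
  have A: "y \<bullet> A x = second_form g u y x - \<kappa> * first_form g u y x" for x y
    by (simp add: A_def first_form_eq second_form_eq assms inner_diff_right inner_add_right
        inner_commute algebra_simps)
  have "A x0 = 0"
  proof (rule selfadjoint_nonneg_kernel[of A x0])
    show "linear A" unfolding A_def
      by (intro linearI) (simp_all add: matrix_vector_right_distrib matrix_vector_mult_scaleR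
        inner_add_right algebra_simps)
    show "x \<bullet> A y = A x \<bullet> y" for x y
    proof -
      have "second_form g u x y = second_form g u y x"
        using hessian_symmetric[OF assms, of x y] by (simp add: second_form_eq assms inner_commute)
      moreover have "first_form g u x y = first_form g u y x"
        by (simp add: first_form_eq assms inner_commute mult.commute)
      ultimately have "x \<bullet> A y = y \<bullet> A x" by (simp add: A)
      then show ?thesis by (simp add: inner_commute)
    qed
    show "0 \<le> x \<bullet> A x" for x using bound[of x] by (simp add: A)
    have "x0 \<noteq> 0" using x0(1) by auto
    then show "x0 \<bullet> A x0 = 0" using first_form_pos[OF assms, of x0] by (simp add: A \<kappa>_def R_def)
  qed
  then have "second_form g u y x0 = \<kappa> * first_form g u y x0" for y
    using A[of y x0] by simp
  moreover have "x0 \<noteq> 0" using x0(1) by auto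
  ultimately have "principal_curvature g u \<kappa>" unfolding principal_curvature_iff[OF assms] by blast
  then show ?thesis using bound by (rule that)
qed

lemma curvature_bound_iff:
  "(\<forall>u\<in>D. \<forall>\<kappa>. principal_curvature g u \<kappa> \<longrightarrow> \<kappa> \<ge> - 1 / normal_length g u) \<longleftrightarrow> second_order_convex"
proof -
  have "(\<forall>\<kappa>. principal_curvature g u \<kappa> \<longrightarrow> \<kappa> \<ge> - 1 / normal_length g u) \<longleftrightarrow> (\<forall>x. 0 \<le> tangent_form u x)"
    if u: "u \<in> D" for u
  proof -
    have N: "0 < normal_length g u"
      using g_pos[OF u] by (simp add: normal_length_def add_pos_nonneg)
    have le_iff: "- 1 / normal_length g u \<le> \<kappa> \<longleftrightarrow> 0 \<le> 1 + normal_length g u * \<kappa>" for \<kappa>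
      using N by (simp add: field_simps) linarith
    show ?thesis
    proof (intro iffI allI impI)
      fix x assume *: "\<forall>\<kappa>. principal_curvature g u \<kappa> \<longrightarrow> \<kappa> \<ge> - 1 / normal_length g u"
      obtain \<kappa> where \<kappa>: "principal_curvature g u \<kappa>"
        "\<And>x. \<kappa> * first_form g u x x \<le> second_form g u x x"
        using exists_least_principal_curvature[OF u] by metis
      have "0 \<le> first_form g u x x" by (simp add: first_form_eq u)
      then have "0 \<le> (1 + normal_length g u * \<kappa>) * first_form g u x x"
        using * \<kappa>(1) le_iff by simp
      also have "\<dots> = first_form g u x x + normal_length g u * (\<kappa> * first_form g u x x)"
        by (simp add: algebra_simps)
      also have "\<dots> \<le> first_form g u x x + normal_length g u * second_form g u x x"
        using \<kappa>(2)[of x] N by simp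
      finally show "0 \<le> tangent_form u x" by (simp add: tangent_form_eq u)
    next
      fix \<kappa> assume *: "\<forall>x. 0 \<le> tangent_form u x" and "principal_curvature g u \<kappa>"
      then obtain \<xi> where \<xi>: "\<xi> \<noteq> 0" "second_form g u \<xi> \<xi> = \<kappa> * first_form g u \<xi> \<xi>"
        by (auto simp: principal_curvature_iff u)
      have "0 \<le> (1 + normal_length g u * \<kappa>) * first_form g u \<xi> \<xi>"
        using *[rule_format, of \<xi>] by (simp add: tangent_form_eq u \<xi>(2) algebra_simps)
      then have "0 \<le> 1 + normal_length g u * \<kappa>"
        using first_form_pos[OF u \<xi>(1)] by (simp add: zero_le_mult_iff)
      then show "- 1 / normal_length g u \<le> \<kappa>" by (simp only: le_iff)
    qed
  qed
  then show ?thesis by (simp add: second_order_convex_def)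
qed

section \<open>Convexity in the Poincare metric\<close>

lemma mem_upper_diff_iff: "(x, v) \<in> upper UNIV - Omega D g \<longleftrightarrow> 0 < v \<and> g x \<le> v"
  by (auto simp: upper_def mem_Omega_iff)

text \<open>
  In the coordinates \<open>x\<close> and \<open>((norm x)\<^sup>2 + v\<^sup>2) / 2\<close>, vertical semicircles become straight chords of
  the paraboloid, and the exterior of \<open>Omega D g\<close> becomes the region above \<open>Phi g\<close>.
\<close>

lemma semicircle_Int_exterior:
  assumes "norm e = 1" "0 < r"
  shows "(\<lambda>\<rho>. (a + \<rho> *\<^sub>R e, sqrt (r\<^sup>2 - \<rho>\<^sup>2))) ` {-r<..<r} \<inter> (upper UNIV - Omega D g)
    = (\<lambda>\<rho>. (a + \<rho> *\<^sub>R e, sqrt (r\<^sup>2 - \<rho>\<^sup>2))) `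
        {\<rho> \<in> {-r<..<r}. Phi g (a + \<rho> *\<^sub>R e) \<le> ((norm a)\<^sup>2 + r\<^sup>2) / 2 + \<rho> * (a \<bullet> e)}"
proof -
  have "(a + \<rho> *\<^sub>R e, sqrt (r\<^sup>2 - \<rho>\<^sup>2)) \<in> upper UNIV - Omega D g
      \<longleftrightarrow> Phi g (a + \<rho> *\<^sub>R e) \<le> ((norm a)\<^sup>2 + r\<^sup>2) / 2 + \<rho> * (a \<bullet> e)" if "\<rho> \<in> {-r<..<r}" for \<rho>
  proof -
    have "\<bar>\<rho>\<bar>\<^sup>2 < r\<^sup>2" using that by (intro power_strict_mono) auto
    then have pos: "0 < r\<^sup>2 - \<rho>\<^sup>2" by simp
    have line: "(norm (a + \<rho> *\<^sub>R e))\<^sup>2 = (norm a)\<^sup>2 + 2 * \<rho> * (a \<bullet> e) + \<rho>\<^sup>2"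
    proof -
      have "e \<bullet> e = 1" using assms(1) by (simp flip: power2_norm_eq_inner)
      then show ?thesis unfolding power2_norm_eq_inner
        by (simp add: inner_add_left inner_add_right inner_commute power2_eq_square)
    qed
    have "Phi g (a + \<rho> *\<^sub>R e) \<le> ((norm a)\<^sup>2 + r\<^sup>2) / 2 + \<rho> * (a \<bullet> e)
        \<longleftrightarrow> (g (a + \<rho> *\<^sub>R e))\<^sup>2 \<le> r\<^sup>2 - \<rho>\<^sup>2"
      unfolding Phi_def line by (intro iffI; simp add: field_simps)
    also have "\<dots> \<longleftrightarrow> g (a + \<rho> *\<^sub>R e) \<le> sqrt (r\<^sup>2 - \<rho>\<^sup>2)"
      using g_nonneg[of "a + \<rho> *\<^sub>R e"] pos
      by (metis real_le_rsqrt real_sqrt_le_iff real_sqrt_unique)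
    finally show ?thesis using pos unfolding mem_upper_diff_iff by simp
  qed
  then show ?thesis by blast
qed

lemma convex_imp_poincare_convex:
  assumes "convex_on UNIV (Phi g)"
  shows "poincare_convex (upper UNIV - Omega D g)"
  unfolding poincare_convex_def
proof (intro allI impI)
  fix \<gamma> :: "((real^'m) \<times> real) set" assume "poincare_geodesic \<gamma>"
  then consider a where "\<gamma> = {(a, v) | v. 0 < v}"
    | a e r where "norm e = 1" "0 < r"
        "\<gamma> = {(a + (r * cos \<theta>) *\<^sub>R e, r * sin \<theta>) | \<theta>. 0 < \<theta> \<and> \<theta> < pi}"
    unfolding poincare_geodesic_def by blast
  then show "connected (\<gamma> \<inter> (upper UNIV - Omega D g))"
  proof cases
    case 1
    then have "\<gamma> \<inter> (upper UNIV - Omega D g) = Pair a ` ({0<..} \<inter> {g a..})"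
      by (auto simp: upper_def mem_Omega_iff)
    moreover have "connected ({0<..} \<inter> {g a..})" by (intro convex_connected convex_Int) auto
    ultimately show ?thesis by (auto intro!: connected_continuous_image continuous_intros)
  next
    case 2
    define K where "K = {\<rho> \<in> {-r<..<r}. Phi g (a + \<rho> *\<^sub>R e) \<le> ((norm a)\<^sup>2 + r\<^sup>2) / 2 + \<rho> * (a \<bullet> e)}"
    have "convex K"
      unfolding convex_alt
    proof (intro ballI allI impI)
      fix x y t assume x: "x \<in> K" and y: "y \<in> K" and t: "0 \<le> t \<and> (t::real) \<le> 1"
      have "(1 - t) *\<^sub>R x + t *\<^sub>R y \<in> {-r<..<r}"
        using x y t convex_real_interval(8)[of "-r" r] unfolding K_def convex_alt by blast
      moreover have "a + ((1 - t) *\<^sub>R x + t *\<^sub>R y) *\<^sub>R e = (1 - t) *\<^sub>R (a + x *\<^sub>R e) + t *\<^sub>R (a + y *\<^sub>R e)"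
        by (simp add: algebra_simps)
      then have "Phi g (a + ((1 - t) *\<^sub>R x + t *\<^sub>R y) *\<^sub>R e)
          \<le> (1 - t) * Phi g (a + x *\<^sub>R e) + t * Phi g (a + y *\<^sub>R e)"
        using assms t by (simp add: convex_on_def)
      moreover have "\<dots> \<le> (1 - t) * (((norm a)\<^sup>2 + r\<^sup>2) / 2 + x * (a \<bullet> e))
          + t * (((norm a)\<^sup>2 + r\<^sup>2) / 2 + y * (a \<bullet> e))"
        using x y t unfolding K_def by (intro add_mono mult_left_mono) auto
      moreover have "\<dots> = ((norm a)\<^sup>2 + r\<^sup>2) / 2 + ((1 - t) *\<^sub>R x + t *\<^sub>R y) * (a \<bullet> e)"
        by (simp add: field_simps)
      ultimately show "(1 - t) *\<^sub>R x + t *\<^sub>R y \<in> K" unfolding K_def by (auto simp del: greaterThanLessThan_iff)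
    qed
    then have "connected K" by (rule convex_connected)
    then show ?thesis
      unfolding 2(3) semicircle_parametrization[OF 2(2)] semicircle_Int_exterior[OF 2(1,2)] K_def[symmetric]
      by (intro connected_continuous_image continuous_intros)
  qed
qed

text \<open>
  Two points of the exterior over \<open>x\<close> and \<open>y\<close> lie on one semicircle. In the dictionary above,
  connectedness of its intersection with the exterior says that the chord between them stays above
  \<open>Phi g\<close>. The slack \<open>\<epsilon>\<close> keeps both points at positive height, also when \<open>x\<close> or \<open>y\<close> is outside \<open>D\<close>.
\<close>

lemma poincare_convex_imp_convex:
  assumes "poincare_convex (upper UNIV - Omega D g)"
  shows "convex_on UNIV (Phi g)"
proof (rule convex_onI)
  fix t :: real and x y :: "real^'m" assume t: "0 < t" "t < 1"
  show "Phi g ((1 - t) *\<^sub>R x + t *\<^sub>R y) \<le> (1 - t) * Phi g x + t * Phi g y"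
  proof (cases "x = y")
    case True
    then show ?thesis by (simp add: algebra_simps flip: scaleR_left.add)
  next
    case False
    show ?thesis
    proof (rule field_le_epsilon)
      fix \<epsilon> :: real assume "0 < \<epsilon>"
      define p where "p = Phi g x + \<epsilon>"
      define q where "q = Phi g y + \<epsilon>"
      define v where "v = 2 * p - (norm x)\<^sup>2"
      define w where "w = 2 * q - (norm y)\<^sup>2"
      have vw: "0 < v" "0 < w"
        using Phi_ge[of x] Phi_ge[of y] \<open>0 < \<epsilon>\<close> by (auto simp: v_def w_def p_def q_def)
      define d where "d = norm (y - x)"
      have d: "0 < d" using False by (simp add: d_def)
      define e where "e = (1 / d) *\<^sub>R (y - x)"
      have e: "norm e = 1" using d by (simp add: e_def d_def)
      then have ee: "e \<bullet> e = 1" by (simp flip: power2_norm_eq_inner)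
      \<comment> \<open>The center of the semicircle is the point of the line through \<open>x\<close> and \<open>y\<close> that is equidistant
        from \<open>(x, sqrt v)\<close> and \<open>(y, sqrt w)\<close>; its position is \<open>l\<close>.\<close>
      define l where "l = (d\<^sup>2 + w - v) / (2 * d)"
      define a where "a = x + l *\<^sub>R e"
      define r where "r = sqrt (l\<^sup>2 + v)"
      have r2: "r\<^sup>2 = l\<^sup>2 + v" using vw by (simp add: r_def)
      have r2': "r\<^sup>2 = (d - l)\<^sup>2 + w" unfolding r2 using d by (simp add: l_def field_simps power2_eq_square)
      have r: "0 < r" using vw by (simp add: r_def add_nonneg_pos)
      have "\<bar>l\<bar>\<^sup>2 < r\<^sup>2" "\<bar>d - l\<bar>\<^sup>2 < r\<^sup>2" using r2 r2' vw by auto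
      then have lr: "\<bar>l\<bar> < r" "\<bar>d - l\<bar> < r" using r by (auto intro: power2_less_imp_less)
      have x: "x = a + (- l) *\<^sub>R e" by (simp add: a_def)
      have "d *\<^sub>R e = y - x" using d by (simp add: e_def)
      then have y: "y = a + (d - l) *\<^sub>R e" by (simp add: a_def scaleR_diff_left)
      define \<alpha> where "\<alpha> \<rho> = ((norm a)\<^sup>2 + r\<^sup>2) / 2 + \<rho> * (a \<bullet> e)" for \<rho>
      have norm_line: "(norm (a + \<rho> *\<^sub>R e))\<^sup>2 = (norm a)\<^sup>2 + 2 * \<rho> * (a \<bullet> e) + \<rho>\<^sup>2" for \<rho>
        unfolding power2_norm_eq_inner
        by (simp add: inner_add_left inner_add_right inner_commute power2_eq_square ee)
      have \<alpha>x: "\<alpha> (- l) = p"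
        using norm_line[of "- l", folded x] by (simp add: \<alpha>_def r2 v_def field_simps)
      have \<alpha>y: "\<alpha> (d - l) = q"
        using norm_line[of "d - l", folded y] by (simp add: \<alpha>_def r2' w_def field_simps)
      define K where "K = {\<rho> \<in> {-r<..<r}. Phi g (a + \<rho> *\<^sub>R e) \<le> \<alpha> \<rho>}"
      define c where "c \<rho> = (a + \<rho> *\<^sub>R e, sqrt (r\<^sup>2 - \<rho>\<^sup>2))" for \<rho>
      have "poincare_geodesic (c ` {-r<..<r})"
        unfolding poincare_geodesic_def c_def semicircle_parametrization[OF r, symmetric]
        using e r by blast
      then have "connected (c ` {-r<..<r} \<inter> (upper UNIV - Omega D g))"
        using assms by (simp add: poincare_convex_def)
      then have "connected (c ` K)"
        unfolding c_def K_def \<alpha>_def semicircle_Int_exterior[OF e r] .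
      then have "connected ((\<lambda>z. (fst z - a) \<bullet> e) ` (c ` K))"
        by (rule connected_continuous_image[rotated]) (intro continuous_intros)
      moreover have "(\<lambda>z. (fst z - a) \<bullet> e) ` (c ` K) = K"
        by (simp add: image_image c_def ee)
      ultimately have "connected K" by simp
      moreover have "- l \<in> K" using lr(1) x \<alpha>x \<open>0 < \<epsilon>\<close> by (auto simp: K_def p_def)
      moreover have "d - l \<in> K" using lr(2) y \<alpha>y \<open>0 < \<epsilon>\<close> by (auto simp: K_def q_def)
      ultimately have "{- l..d - l} \<subseteq> K" by (rule connected_contains_Icc)
      moreover have "t * d - l \<in> {- l..d - l}" using t d by simp
      ultimately have "t * d - l \<in> K" by blast
      then have "Phi g (a + (t * d - l) *\<^sub>R e) \<le> \<alpha> (t * d - l)" by (simp add: K_def)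
      also have "a + (t * d - l) *\<^sub>R e = (1 - t) *\<^sub>R x + t *\<^sub>R y"
        by (subst x, subst y) (simp add: algebra_simps)
      also have "\<alpha> (t * d - l) = (1 - t) * \<alpha> (- l) + t * \<alpha> (d - l)"
        by (simp add: \<alpha>_def field_simps)
      also have "\<dots> = (1 - t) * Phi g x + t * Phi g y + \<epsilon>"
        unfolding \<alpha>x \<alpha>y by (simp add: p_def q_def algebra_simps)
      finally show "Phi g ((1 - t) *\<^sub>R x + t *\<^sub>R y) \<le> (1 - t) * Phi g x + t * Phi g y + \<epsilon>" .
    qed
  qed
qed simp

lemma second_order_convex_iff_tangent_supported: "second_order_convex \<longleftrightarrow> tangent_supported"
  and second_order_convex_iff_convex_on: "second_order_convex \<longleftrightarrow> convex_on UNIV (Phi g)"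
  using second_order_imp_tangent_supported tangent_supported_imp_convex
    convex_Phi_imp_subdomains convex_subdomains_imp_second_order by blast+

end

(* The list runs through (i) with its three reformulations, (ii) convex and strictly convex,
   (iii) with its matrix version, and (iv)-(x). *)
theorem theorem3p1:
  fixes D :: "(real^'m) set" and g :: "real^'m \<Rightarrow> real"
  assumes "open D" and "connected D" and "D \<noteq> {}" and "bounded D"
    and "\<And>u. u \<in> D \<Longrightarrow> 0 < g u"
    and "\<And>u. u \<notin> D \<Longrightarrow> g u = 0"
    and "C2_on D g"
    and "\<And>\<xi>. \<xi> \<in> frontier D \<Longrightarrow> (g \<longlongrightarrow> 0) (at \<xi> within D)"
  shows "all_equivalent
   [
     \<forall>S. convex_subdomain S D \<longrightarrow> convex_on S (Phi g),
     \<forall>u\<in>D. pos_semidef (hessian (Phi g) u),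
     convex_on UNIV (Phi g),
     convex (W_set - V_set D g),
     \<forall>a b. b > 0 \<longrightarrow>
       (\<forall>S. convex_subdomain S {u \<in> D. g u > b} \<longrightarrow> convex_on S (Phi_c g a b)),
     \<forall>a b. b > 0 \<longrightarrow>
       (\<forall>S. convex_subdomain S {u \<in> D. g u > b} \<longrightarrow> strictly_convex_on S (Phi_c g a b)),
     \<forall>S. convex_subdomain S D \<longrightarrow> monotone_map_on S (foot g),
     \<forall>u\<in>D. pos_semidef (\<chi> i j. jacobian (foot g) (at u) $ i $ j
                              + jacobian (foot g) (at u) $ j $ i),
     Omega D g = (\<Union>u\<in>D. ball (foot g u, 0) (normal_length g u)),
     \<exists>r. (\<forall>u\<in>D. 0 < r u) \<and> Omega D g = (\<Union>u\<in>D. ball (u, 0) (r u)),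
     \<forall>u\<in>D. \<forall>u'\<in>D. u \<noteq> u' \<longrightarrow> normal_segment g u \<inter> normal_segment g u' = {},
     \<forall>u\<in>D. \<forall>\<kappa>. principal_curvature g u \<kappa> \<longrightarrow> \<kappa> \<ge> - 1 / normal_length g u,
     \<forall>x\<in>upper (Omega D g). \<exists>!y. y \<in> upper (frontier (Omega D g)) \<and>
       (\<forall>z\<in>upper (frontier (Omega D g)). dist x y \<le> dist x z),
     \<forall>y\<in>upper (frontier (Omega D g)). \<exists>u\<in>D.
       \<forall>z\<in>frontier (Omega D g). dist (u, 0) y \<le> dist (u, 0) z,
     poincare_convex (upper UNIV - Omega D g) ]"
proof -
  interpret graph_domain D g
    using assms by unfold_locales
  let ?E = "second_order_convex"
  note supp = second_order_convex_iff_tangent_supported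
  note conv = second_order_convex_iff_convex_on
  have 1: "(\<forall>S. convex_subdomain S D \<longrightarrow> convex_on S (Phi g)) \<longleftrightarrow> ?E"
    using convex_subdomains_imp_second_order convex_Phi_imp_subdomains conv by blast
  have 5: "(\<forall>a b. b > 0 \<longrightarrow>
       (\<forall>S. convex_subdomain S {u \<in> D. g u > b} \<longrightarrow> convex_on S (Phi_c g a b))) \<longleftrightarrow> ?E"
    and 6: "(\<forall>a b. b > 0 \<longrightarrow>
       (\<forall>S. convex_subdomain S {u \<in> D. g u > b} \<longrightarrow> strictly_convex_on S (Phi_c g a b))) \<longleftrightarrow> ?E"
    using Phi_c_convex_imp_second_order tangent_supported_imp_Phi_c_strictly_convex
      strictly_convex_on_imp_convex_on supp by blast+
  have 7: "(\<forall>S. convex_subdomain S D \<longrightarrow> monotone_map_on S (foot g)) \<longleftrightarrow> ?E"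
    using monotone_subdomains_imp_second_order monotone_if_convex 1
    unfolding convex_subdomain_def by blast
  have 10: "(\<exists>r. (\<forall>u\<in>D. 0 < r u) \<and> Omega D g = (\<Union>u\<in>D. ball (u, 0) (r u))) \<longleftrightarrow> ?E"
    using centered_ball_cover centered_ball_cover_imp_convex supp conv by blast
  have 11: "(\<forall>u\<in>D. \<forall>u'\<in>D. u \<noteq> u' \<longrightarrow> normal_segment g u \<inter> normal_segment g u' = {}) \<longleftrightarrow> ?E"
    using tangent_supported_imp_normals_disjoint normals_disjoint_imp_ball_extension
      tangent_supported_if_ball_extension supp by blast
  have 13: "(\<forall>x\<in>upper (Omega D g). \<exists>!y. y \<in> upper (frontier (Omega D g)) \<and>
       (\<forall>z\<in>upper (frontier (Omega D g)). dist x y \<le> dist x z)) \<longleftrightarrow> ?E"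
    using tangent_supported_imp_unique_nearest unique_nearest_imp_ball_extension
      tangent_supported_if_ball_extension supp by blast
  have 14: "(\<forall>y\<in>upper (frontier (Omega D g)). \<exists>u\<in>D.
       \<forall>z\<in>frontier (Omega D g). dist (u, 0) y \<le> dist (u, 0) z) \<longleftrightarrow> ?E"
    using tangent_supported_imp_graph_nearest graph_nearest_imp_convex supp conv by blast
  have 15: "poincare_convex (upper UNIV - Omega D g) \<longleftrightarrow> ?E"
    using convex_imp_poincare_convex poincare_convex_imp_convex conv by blast
  show ?thesis
    unfolding 1 pos_semidef_hessian_Phi_iff conv[symmetric] convex_W_minus_V_iff 5 6 7
      pos_semidef_foot_iff foot_ball_cover_iff supp[symmetric] 10 11 curvature_bound_iff 13 14 15
    by (simp add: all_equivalent_def)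
qed

end
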